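(* For every $\varepsilon>0$, the horizontal Ricci curvature of the adjoint connection $\widehat\nabla^\varepsilon=\nabla+\frac1\varepsilon J$ is given by \[ \widehat{\mathfrak{Ric}}{}^\varepsilon_{\mathcal H}=\mathfrak{Ric}_{\mathcal H}-\frac1\varepsilon\delta^*_{\mathcal H}T+\frac1\varepsilon\mathbf J^2, \] where $\delta^*_{\mathcal H}T$ denotes the adjoint of $\delta_{\mathcal H}T$ with respect to the metric $g$.
   Context: $\mathbb M$ is a smooth connected compact manifold of dimension $n+m$ with Riemannian metric $g$ and an $m$-dimensional foliation that is Riemannian with bundle-like metric and totally geodesic leaves: $\mathbb M$ is covered by open sets $U_\alpha$ with submersions $\pi_\alpha:U_\alpha\to U^0_\alpha$ onto open subsets of $\mathbb R^n$, related on overlaps by local diffeomorphisms; each $\pi_\alpha$ is a Riemannian submersion onto $U^0_\alpha$ with a given Riemannian structure; the leaves are totally geodesic. The vertical bundle $\mathcal V$ has fibers $\ker d\pi_\alpha$, the horizontal bundle is $\mathcal H=\mathcal V^\perp$, assumed bracket-generating; $g_{\mathcal H},g_{\mathcal V}$ are the restrictions of $g$, $\pi_{\mathcal H},\pi_{\mathcal V}$ the orthogonal projections. With $\nabla^R$ the Levi-Civita connection, the Bott connection $\nabla$ is: $\nabla_XY=\pi_{\mathcal H}(\nabla^R_XY)$ for $X,Y\in\Gamma^\infty(\mathcal H)$; $\pi_{\mathcal H}([X,Y])$ for $X\in\Gamma^\infty(\mathcal V),Y\in\Gamma^\infty(\mathcal H)$; $\pi_{\mathcal V}([X,Y])$ for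 $X\in\Gamma^\infty(\mathcal H),Y\in\Gamma^\infty(\mathcal V)$; $\pi_{\mathcal V}(\nabla^R_XY)$ for $X,Y\in\Gamma^\infty(\mathcal V)$. Its torsion is $T(X,Y)=\nabla_XY-\nabla_YX-[X,Y]$. For vertical $Z$, $J_Z$ is the skew-symmetric endomorphism of $\mathcal H$ with $g_{\mathcal H}(J_ZX,Y)=g_{\mathcal V}(Z,T(X,Y))$, extended by $0$ on $\mathcal V$; $J_Z=0$ for horizontal $Z$. $\widehat\nabla^\varepsilon_XY=\nabla_XY+\frac1\varepsilon J_XY$. For a local orthonormal horizontal frame $X_1,\dots,X_n$ and a local orthonormal vertical frame $Z_1,\dots,Z_m$: $\mathbf J^2=\sum_\ell J_{Z_\ell}J_{Z_\ell}$ and $\delta_{\mathcal H}T(X)=\sum_{j=1}^n(\nabla_{X_j}T)(X_j,X)$. With curvature tensors $R(X,Y)=[\nabla_X,\nabla_Y]-\nabla_{[X,Y]}$ and $\widehat R^\varepsilon$ (same formula with $\widehat\nabla^\varepsilon$), the horizontal Ricci curvatures are $\mathbf{Ric}_{\mathcal H}(X,Y)=\sum_ig_{\mathcal H}(R(X_i,X)Y,X_i)$ and $\widehat{\mathbf{Ric}}{}^\varepsilon_{\mathcal H}(X,Y)=\sum_ig_{\mathcal H}(\widehat R^\varepsilon(X_i,X)Y,X_i)$ (where $g_{\mathcal H}$ of a vector means pairing its horizontal part), and the corresponding operators are defined by $g(\mathfrak{Ric}_{\mathcal H}X,Y)=\mathbf{Ric}_{\mathcal H}(X,Y)$, $g(\widehat{\mathfrak{Ric}}{}^\varepsilon_{\mathcal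 H}X,Y)=\widehat{\mathbf{Ric}}{}^\varepsilon_{\mathcal H}(X,Y)$ for all vectors $X,Y$. *)

theory Defs
  imports "HOL-Analysis.Analysis" "HOL-Library.Function_Algebras"
begin

section \<open>Smooth maps between Euclidean spaces\<close>

text \<open>For open \<open>S\<close>: all iterated directional derivatives of order at most \<open>k\<close> exist and are
  continuous on \<open>S\<close>.\<close>

primrec Ck_on ::
  "nat \<Rightarrow> 'e::euclidean_space set \<Rightarrow> ('e \<Rightarrow> 'f::real_normed_vector) \<Rightarrow> bool" where
  "Ck_on 0 S f \<longleftrightarrow> continuous_on S f"
| "Ck_on (Suc k) S f \<longleftrightarrow>
     (\<forall>x\<in>S. f differentiable (at x)) \<and> (\<forall>v. Ck_on k S (\<lambda>x. frechet_derivative f (at x) v))"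

definition eucl_smooth_on ::
  "'e::euclidean_space set \<Rightarrow> ('e \<Rightarrow> 'f::real_normed_vector) \<Rightarrow> bool" where
  "eucl_smooth_on S f \<longleftrightarrow> (\<forall>k. Ck_on k S f)"

definition eucl_diffeo_on :: "'b::euclidean_space set \<Rightarrow> ('b \<Rightarrow> 'b) \<Rightarrow> bool" where
  "eucl_diffeo_on S f \<longleftrightarrow>
     open S \<and> open (f ` S) \<and> inj_on f S \<and>
     eucl_smooth_on S f \<and> eucl_smooth_on (f ` S) (inv_into S f)"


section \<open>Smooth manifolds, tangent vectors and vector fields\<close>

text \<open>A chart is a pair \<open>(U, \<phi>)\<close>; only the values of \<open>\<phi>\<close> on \<open>U\<close> matter. The manifold is the
  whole type \<open>'a\<close>, and its dimension is the dimension of the model space \<open>'e\<close>.\<close>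

type_synonym ('a, 'e) chart = "'a set \<times> ('a \<Rightarrow> 'e)"

definition smooth_atlas ::
  "('a::{t2_space,second_countable_topology}, 'e::euclidean_space) chart set \<Rightarrow> bool" where
  "smooth_atlas A \<longleftrightarrow>
     (\<Union>(U, \<phi>)\<in>A. U) = UNIV \<and>
     (\<forall>(U, \<phi>)\<in>A. open U \<and> open (\<phi> ` U) \<and> homeomorphism U (\<phi> ` U) \<phi> (inv_into U \<phi>)) \<and>
     (\<forall>(U, \<phi>)\<in>A. \<forall>(V, \<psi>)\<in>A. eucl_smooth_on (\<phi> ` (U \<inter> V)) (\<psi> \<circ> inv_into U \<phi>))"

definition smooth_on ::
  "('a, 'e::euclidean_space) chart set \<Rightarrow> 'a set \<Rightarrow> ('a \<Rightarrow> 'f::real_normed_vector) \<Rightarrow> bool" where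
  "smooth_on A W f \<longleftrightarrow> (\<forall>(U, \<phi>)\<in>A. eucl_smooth_on (\<phi> ` (U \<inter> W)) (f \<circ> inv_into U \<phi>))"

definition smooth_near ::
  "('a::topological_space, 'e::euclidean_space) chart set \<Rightarrow> 'a \<Rightarrow> ('a \<Rightarrow> real) \<Rightarrow> bool" where
  "smooth_near A p f \<longleftrightarrow> (\<exists>W. open W \<and> p \<in> W \<and> smooth_on A W f)"

text \<open>A tangent vector at \<open>p\<close> is a derivation at \<open>p\<close> of the functions that are smooth near \<open>p\<close>.
  Germs need no quotient: if \<open>f\<close> vanishes on a neighbourhood \<open>V\<close> of \<open>p\<close>, then the Leibniz rule
  applied to the product of \<open>f\<close> and the indicator function of the complement of \<open>V\<close> gives
  \<open>v f = 0\<close>. The last clause fixes the irrelevant values, so that equality of derivations is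
  equality of functions. Sums of functions, tangent vectors and vector fields are the pointwise
  ones from \<open>Function_Algebras\<close>.\<close>

type_synonym 'a tvec = "('a \<Rightarrow> real) \<Rightarrow> real"
type_synonym 'a vfield = "'a \<Rightarrow> 'a tvec"

definition tangent_space ::
  "('a::topological_space, 'e::euclidean_space) chart set \<Rightarrow> 'a \<Rightarrow> 'a tvec set" where
  "tangent_space A p = {v.
     (\<forall>f h. smooth_near A p f \<and> smooth_near A p h \<longrightarrow>
        v (f + h) = v f + v h \<and> v (f * h) = v f * h p + f p * v h) \<and>
     (\<forall>c f. smooth_near A p f \<longrightarrow> v (\<lambda>q. c * f q) = c * v f) \<and>
     (\<forall>f. \<not> smooth_near A p f \<longrightarrow> v f = 0)}"

definition tscale :: "real \<Rightarrow> 'a tvec \<Rightarrow> 'a tvec" (infixr "\<cdot>\<^sub>t" 75) where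
  "c \<cdot>\<^sub>t v = (\<lambda>f. c * v f)"

definition fscale :: "('a \<Rightarrow> real) \<Rightarrow> 'a vfield \<Rightarrow> 'a vfield" (infixr "\<cdot>\<^sub>f" 75) where
  "\<phi> \<cdot>\<^sub>f X = (\<lambda>p. \<phi> p \<cdot>\<^sub>t X p)"

definition differential ::
  "('a \<Rightarrow> 'b::euclidean_space) \<Rightarrow> 'a tvec \<Rightarrow> 'b" where
  "differential F v = (\<Sum>b\<in>Basis. v (\<lambda>q. F q \<bullet> b) *\<^sub>R b)"

text \<open>Local vector fields are total functions whose values outside the open set in question
  are irrelevant.\<close>

definition smooth_vf ::
  "('a::topological_space, 'e::euclidean_space) chart set \<Rightarrow> 'a set \<Rightarrow> 'a vfield \<Rightarrow> bool" where
  "smooth_vf A U X \<longleftrightarrow>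
     (\<forall>p\<in>U. X p \<in> tangent_space A p) \<and>
     (\<forall>W f. open W \<and> W \<subseteq> U \<and> smooth_on A W f \<longrightarrow> smooth_on A W (\<lambda>p. X p f))"

definition smooth_vf_near ::
  "('a::topological_space, 'e::euclidean_space) chart set \<Rightarrow> 'a \<Rightarrow> 'a vfield \<Rightarrow> bool" where
  "smooth_vf_near A p X \<longleftrightarrow> (\<exists>W. open W \<and> p \<in> W \<and> smooth_vf A W X)"

definition lie_bracket ::
  "('a::topological_space, 'e::euclidean_space) chart set \<Rightarrow> 'a vfield \<Rightarrow> 'a vfield \<Rightarrow> 'a vfield" where
  "lie_bracket A X Y = (\<lambda>p f.
     if smooth_near A p f then X p (\<lambda>q. Y q f) - Y p (\<lambda>q. X q f) else 0)"


section \<open>Riemannian metrics and the Levi-Civita connection\<close>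

type_synonym 'a metric_field = "'a \<Rightarrow> 'a tvec \<Rightarrow> 'a tvec \<Rightarrow> real"

definition riemannian_metric ::
  "('a::topological_space, 'e::euclidean_space) chart set \<Rightarrow> 'a metric_field \<Rightarrow> bool" where
  "riemannian_metric A g \<longleftrightarrow>
     (\<forall>p. \<forall>u\<in>tangent_space A p. \<forall>v\<in>tangent_space A p. \<forall>w\<in>tangent_space A p. \<forall>c.
        g p (u + v) w = g p u w + g p v w \<and>
        g p (c \<cdot>\<^sub>t u) w = c * g p u w \<and>
        g p u v = g p v u \<and>
        (u \<noteq> 0 \<longrightarrow> g p u u > 0)) \<and>
     (\<forall>U X Y. open U \<and> smooth_vf A U X \<and> smooth_vf A U Y \<longrightarrow>
        smooth_on A U (\<lambda>p. g p (X p) (Y p)))"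

text \<open>A Riemannian metric on an open subset of a Euclidean space \<open>'b\<close>, whose tangent spaces are
  identified with \<open>'b\<close>.\<close>

definition eucl_riemannian_metric ::
  "'b::euclidean_space set \<Rightarrow> ('b \<Rightarrow> 'b \<Rightarrow> 'b \<Rightarrow> real) \<Rightarrow> bool" where
  "eucl_riemannian_metric S h \<longleftrightarrow>
     (\<forall>y\<in>S. bilinear (h y) \<and> (\<forall>u v. h y u v = h y v u) \<and> (\<forall>u. u \<noteq> 0 \<longrightarrow> h y u u > 0)) \<and>
     (\<forall>u v. eucl_smooth_on S (\<lambda>y. h y u v))"

text \<open>Connections are operators on (total functions representing) local vector fields. Since the
  axioms are required for local fields on every open set, and the functions \<open>f\<close> below are only
  required to be smooth on that set, the operator is automatically local. The Levi-Civita
  connection is the torsion-free metric affine connection.\<close>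

definition affine_connection ::
  "('a::topological_space, 'e::euclidean_space) chart set \<Rightarrow>
   ('a vfield \<Rightarrow> 'a vfield \<Rightarrow> 'a vfield) \<Rightarrow> bool" where
  "affine_connection A D \<longleftrightarrow>
     (\<forall>U X X' Y Y' f. open U \<and> smooth_vf A U X \<and> smooth_vf A U X' \<and>
        smooth_vf A U Y \<and> smooth_vf A U Y' \<and> smooth_on A U f \<longrightarrow>
        smooth_vf A U (D X Y) \<and>
        (\<forall>p\<in>U. D (X + X') Y p = D X Y p + D X' Y p \<and>
               D (f \<cdot>\<^sub>f X) Y p = f p \<cdot>\<^sub>t D X Y p \<and>
               D X (Y + Y') p = D X Y p + D X Y' p \<and>
               D X (f \<cdot>\<^sub>f Y) p = X p f \<cdot>\<^sub>t Y p + f p \<cdot>\<^sub>t D X Y p))"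

definition torsion ::
  "('a::topological_space, 'e::euclidean_space) chart set \<Rightarrow>
   ('a vfield \<Rightarrow> 'a vfield \<Rightarrow> 'a vfield) \<Rightarrow> 'a vfield \<Rightarrow> 'a vfield \<Rightarrow> 'a vfield" where
  "torsion A D X Y = D X Y - D Y X - lie_bracket A X Y"

definition curvature ::
  "('a::topological_space, 'e::euclidean_space) chart set \<Rightarrow>
   ('a vfield \<Rightarrow> 'a vfield \<Rightarrow> 'a vfield) \<Rightarrow> 'a vfield \<Rightarrow> 'a vfield \<Rightarrow> 'a vfield \<Rightarrow> 'a vfield" where
  "curvature A D X Y Z = D X (D Y Z) - D Y (D X Z) - D (lie_bracket A X Y) Z"

definition levi_civita ::
  "('a::topological_space, 'e::euclidean_space) chart set \<Rightarrow> 'a metric_field \<Rightarrow>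
   ('a vfield \<Rightarrow> 'a vfield \<Rightarrow> 'a vfield) \<Rightarrow> bool" where
  "levi_civita A g D \<longleftrightarrow>
     affine_connection A D \<and>
     (\<forall>U X Y Z. open U \<and> smooth_vf A U X \<and> smooth_vf A U Y \<and> smooth_vf A U Z \<longrightarrow>
        (\<forall>p\<in>U. torsion A D X Y p = 0 \<and>
               X p (\<lambda>q. g q (Y q) (Z q)) = g p (D X Y p) (Z p) + g p (Y p) (D X Z p)))"


section \<open>Riemannian foliations\<close>

text \<open>The metric \<open>base_metric M \<alpha>\<close> lives on the open set \<open>submersion M \<alpha> ` patch M \<alpha>\<close> of the
  \<open>n\<close>-dimensional space \<open>'b\<close>.\<close>

record ('a, 'e, 'i, 'b) foliated =
  atlas :: "('a, 'e) chart set"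
  metric :: "'a metric_field"
  indices :: "'i set"
  patch :: "'i \<Rightarrow> 'a set"
  submersion :: "'i \<Rightarrow> 'a \<Rightarrow> 'b"
  base_metric :: "'i \<Rightarrow> 'b \<Rightarrow> 'b \<Rightarrow> 'b \<Rightarrow> real"

text \<open>For a foliation the kernels of the differentials of any two of the submersions defined at
  \<open>p\<close> coincide, so the intersection below is just any one of them.\<close>

definition vert ::
  "('a::topological_space, 'e::euclidean_space, 'i, 'b::euclidean_space) foliated \<Rightarrow> 'a \<Rightarrow> 'a tvec set" where
  "vert M p = {v \<in> tangent_space (atlas M) p.
     \<forall>\<alpha>\<in>indices M. p \<in> patch M \<alpha> \<longrightarrow> differential (submersion M \<alpha>) v = 0}"

definition hor ::
  "('a::topological_space, 'e::euclidean_space, 'i, 'b::euclidean_space) foliated \<Rightarrow> 'a \<Rightarrow> 'a tvec set" where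
  "hor M p = {u \<in> tangent_space (atlas M) p. \<forall>v\<in>vert M p. metric M p u v = 0}"

definition foliation ::
  "('a::topological_space, 'e::euclidean_space, 'i, 'b::euclidean_space) foliated \<Rightarrow> bool" where
  "foliation M \<longleftrightarrow>
     (\<Union>\<alpha>\<in>indices M. patch M \<alpha>) = UNIV \<and>
     (\<forall>\<alpha>\<in>indices M. open (patch M \<alpha>) \<and> open (submersion M \<alpha> ` patch M \<alpha>) \<and>
        smooth_on (atlas M) (patch M \<alpha>) (submersion M \<alpha>) \<and>
        (\<forall>p\<in>patch M \<alpha>. differential (submersion M \<alpha>) ` tangent_space (atlas M) p = UNIV)) \<and>
     (\<forall>\<alpha>\<in>indices M. \<forall>\<beta>\<in>indices M. \<forall>p\<in>patch M \<alpha> \<inter> patch M \<beta>.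
        \<exists>N S \<gamma>. open N \<and> p \<in> N \<and> N \<subseteq> patch M \<alpha> \<inter> patch M \<beta> \<and>
          eucl_diffeo_on S \<gamma> \<and> submersion M \<alpha> ` N \<subseteq> S \<and>
          (\<forall>q\<in>N. submersion M \<beta> q = \<gamma> (submersion M \<alpha> q)))"

definition bundle_like ::
  "('a::topological_space, 'e::euclidean_space, 'i, 'b::euclidean_space) foliated \<Rightarrow> bool" where
  "bundle_like M \<longleftrightarrow>
     (\<forall>\<alpha>\<in>indices M.
        eucl_riemannian_metric (submersion M \<alpha> ` patch M \<alpha>) (base_metric M \<alpha>) \<and>
        (\<forall>p\<in>patch M \<alpha>. \<forall>u\<in>hor M p. \<forall>v\<in>hor M p.
           base_metric M \<alpha> (submersion M \<alpha> p)
             (differential (submersion M \<alpha>) u) (differential (submersion M \<alpha>) v) = metric M p u v))"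

definition proj_vert ::
  "('a::topological_space, 'e::euclidean_space, 'i, 'b::euclidean_space) foliated \<Rightarrow> 'a vfield \<Rightarrow> 'a vfield" where
  "proj_vert M X = (\<lambda>p. THE v. v \<in> vert M p \<and> X p - v \<in> hor M p)"

definition proj_hor ::
  "('a::topological_space, 'e::euclidean_space, 'i, 'b::euclidean_space) foliated \<Rightarrow> 'a vfield \<Rightarrow> 'a vfield" where
  "proj_hor M X = (\<lambda>p. THE u. u \<in> hor M p \<and> X p - u \<in> vert M p)"

text \<open>Vanishing of the second fundamental form of every leaf: the normal part of \<open>D X Y\<close> is zero
  for fields tangent to the leaves.\<close>

definition totally_geodesic_leaves ::
  "('a::topological_space, 'e::euclidean_space, 'i, 'b::euclidean_space) foliated \<Rightarrow>
   ('a vfield \<Rightarrow> 'a vfield \<Rightarrow> 'a vfield) \<Rightarrow> bool" where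
  "totally_geodesic_leaves M D \<longleftrightarrow>
     (\<forall>U X Y. open U \<and> smooth_vf (atlas M) U X \<and> smooth_vf (atlas M) U Y \<and>
        (\<forall>p\<in>U. X p \<in> vert M p \<and> Y p \<in> vert M p) \<longrightarrow>
        (\<forall>p\<in>U. proj_hor M (D X Y) p = 0))"

text \<open>The Lie algebra of vector fields on \<open>U\<close> generated by the horizontal ones.\<close>

inductive hor_lie_algebra ::
  "('a::topological_space, 'e::euclidean_space, 'i, 'b::euclidean_space) foliated \<Rightarrow>
   'a set \<Rightarrow> 'a vfield \<Rightarrow> bool" for M U where
  hor: "smooth_vf (atlas M) U X \<Longrightarrow> (\<forall>p\<in>U. X p \<in> hor M p) \<Longrightarrow> hor_lie_algebra M U X"
| add: "hor_lie_algebra M U X \<Longrightarrow> hor_lie_algebra M U Y \<Longrightarrow> hor_lie_algebra M U (X + Y)"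
| scale: "hor_lie_algebra M U X \<Longrightarrow> hor_lie_algebra M U ((\<lambda>_. c) \<cdot>\<^sub>f X)"
| bracket: "hor_lie_algebra M U X \<Longrightarrow> hor_lie_algebra M U Y \<Longrightarrow>
            hor_lie_algebra M U (lie_bracket (atlas M) X Y)"

definition bracket_generating ::
  "('a::topological_space, 'e::euclidean_space, 'i, 'b::euclidean_space) foliated \<Rightarrow> bool" where
  "bracket_generating M \<longleftrightarrow>
     (\<forall>p. \<forall>v\<in>tangent_space (atlas M) p.
        \<exists>U X. open U \<and> p \<in> U \<and> hor_lie_algebra M U X \<and> X p = v)"

text \<open>\<open>D\<close> is the Levi-Civita connection of the metric; \<open>n = DIM('b)\<close>.\<close>

definition totally_geodesic_riemannian_foliation ::
  "('a::{t2_space,second_countable_topology}, 'e::euclidean_space, 'i, 'b::euclidean_space) foliated \<Rightarrow>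
   ('a vfield \<Rightarrow> 'a vfield \<Rightarrow> 'a vfield) \<Rightarrow> nat \<Rightarrow> bool" where
  "totally_geodesic_riemannian_foliation M D m \<longleftrightarrow>
     smooth_atlas (atlas M) \<and> compact (UNIV :: 'a set) \<and> connected (UNIV :: 'a set) \<and>
     DIM('e) = DIM('b) + m \<and>
     riemannian_metric (atlas M) (metric M) \<and> levi_civita (atlas M) (metric M) D \<and>
     foliation M \<and> bundle_like M \<and> totally_geodesic_leaves M D \<and> bracket_generating M"

definition orthonormal_frame ::
  "('a::topological_space, 'e::euclidean_space, 'i, 'b::euclidean_space) foliated \<Rightarrow>
   ('a \<Rightarrow> 'a tvec set) \<Rightarrow> nat \<Rightarrow> 'a set \<Rightarrow> (nat \<Rightarrow> 'a vfield) \<Rightarrow> bool" where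
  "orthonormal_frame M E k U F \<longleftrightarrow>
     (\<forall>i<k. smooth_vf (atlas M) U (F i)) \<and>
     (\<forall>p\<in>U. (\<forall>i<k. F i p \<in> E p) \<and>
            (\<forall>i<k. \<forall>j<k. metric M p (F i p) (F j p) = (if i = j then 1 else 0)) \<and>
            (\<forall>v\<in>E p. \<exists>c. v = (\<Sum>i<k. c i \<cdot>\<^sub>t F i p)))"


section \<open>The Bott connection and its adjoint connections\<close>

text \<open>The four cases of the definition, extended biadditively to arbitrary vector fields; \<open>D\<close> is
  the Levi-Civita connection.\<close>

definition bott ::
  "('a::topological_space, 'e::euclidean_space, 'i, 'b::euclidean_space) foliated \<Rightarrow>
   ('a vfield \<Rightarrow> 'a vfield \<Rightarrow> 'a vfield) \<Rightarrow> 'a vfield \<Rightarrow> 'a vfield \<Rightarrow> 'a vfield" where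
  "bott M D X Y =
     proj_hor M (D (proj_hor M X) (proj_hor M Y)) +
     proj_hor M (lie_bracket (atlas M) (proj_vert M X) (proj_hor M Y)) +
     proj_vert M (lie_bracket (atlas M) (proj_hor M X) (proj_vert M Y)) +
     proj_vert M (D (proj_vert M X) (proj_vert M Y))"

abbreviation bott_torsion ::
  "('a::topological_space, 'e::euclidean_space, 'i, 'b::euclidean_space) foliated \<Rightarrow>
   ('a vfield \<Rightarrow> 'a vfield \<Rightarrow> 'a vfield) \<Rightarrow> 'a vfield \<Rightarrow> 'a vfield \<Rightarrow> 'a vfield" where
  "bott_torsion M D \<equiv> torsion (atlas M) (bott M D)"

text \<open>\<open>J_op M D Z X\<close> is the field \<open>J\<^sub>Z X\<close>. The projections implement the extension by zero: the
  result vanishes if \<open>Z\<close> is horizontal or \<open>X\<close> is vertical.\<close>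

definition J_op ::
  "('a::topological_space, 'e::euclidean_space, 'i, 'b::euclidean_space) foliated \<Rightarrow>
   ('a vfield \<Rightarrow> 'a vfield \<Rightarrow> 'a vfield) \<Rightarrow> 'a vfield \<Rightarrow> 'a vfield \<Rightarrow> 'a vfield" where
  "J_op M D Z X = (\<lambda>p. THE w. w \<in> hor M p \<and>
     (\<forall>U Y. open U \<and> p \<in> U \<and> smooth_vf (atlas M) U Y \<and> (\<forall>q\<in>U. Y q \<in> hor M q) \<longrightarrow>
        metric M p w (Y p) =
        metric M p (proj_vert M Z p) (bott_torsion M D (proj_hor M X) Y p)))"

definition adjoint_conn ::
  "('a::topological_space, 'e::euclidean_space, 'i, 'b::euclidean_space) foliated \<Rightarrow>
   ('a vfield \<Rightarrow> 'a vfield \<Rightarrow> 'a vfield) \<Rightarrow> real \<Rightarrow> 'a vfield \<Rightarrow> 'a vfield \<Rightarrow> 'a vfield" where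
  "adjoint_conn M D \<epsilon> X Y = bott M D X Y + (\<lambda>_. 1 / \<epsilon>) \<cdot>\<^sub>f J_op M D X Y"

definition J_squared ::
  "('a::topological_space, 'e::euclidean_space, 'i, 'b::euclidean_space) foliated \<Rightarrow>
   ('a vfield \<Rightarrow> 'a vfield \<Rightarrow> 'a vfield) \<Rightarrow> nat \<Rightarrow> (nat \<Rightarrow> 'a vfield) \<Rightarrow> 'a vfield \<Rightarrow> 'a vfield" where
  "J_squared M D m Zf X = (\<Sum>l<m. J_op M D (Zf l) (J_op M D (Zf l) X))"

definition nabla_torsion ::
  "('a::topological_space, 'e::euclidean_space, 'i, 'b::euclidean_space) foliated \<Rightarrow>
   ('a vfield \<Rightarrow> 'a vfield \<Rightarrow> 'a vfield) \<Rightarrow> 'a vfield \<Rightarrow> 'a vfield \<Rightarrow> 'a vfield \<Rightarrow> 'a vfield" where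
  "nabla_torsion M D X Y Z =
     bott M D X (bott_torsion M D Y Z) -
     bott_torsion M D (bott M D X Y) Z - bott_torsion M D Y (bott M D X Z)"

definition delta_torsion ::
  "('a::topological_space, 'e::euclidean_space, 'i, 'b::euclidean_space) foliated \<Rightarrow>
   ('a vfield \<Rightarrow> 'a vfield \<Rightarrow> 'a vfield) \<Rightarrow> (nat \<Rightarrow> 'a vfield) \<Rightarrow> 'a vfield \<Rightarrow> 'a vfield" where
  "delta_torsion M D Xf X = (\<Sum>j<DIM('b). nabla_torsion M D (Xf j) (Xf j) X)"

text \<open>\<open>C\<close> is any connection (the Bott connection or one of its adjoints).\<close>

definition ric_hor ::
  "('a::topological_space, 'e::euclidean_space, 'i, 'b::euclidean_space) foliated \<Rightarrow>
   ('a vfield \<Rightarrow> 'a vfield \<Rightarrow> 'a vfield) \<Rightarrow> (nat \<Rightarrow> 'a vfield) \<Rightarrow>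
   'a vfield \<Rightarrow> 'a vfield \<Rightarrow> 'a \<Rightarrow> real" where
  "ric_hor M C Xf X Y = (\<lambda>p. \<Sum>i<DIM('b).
     metric M p (proj_hor M (curvature (atlas M) C (Xf i) X Y) p) (Xf i p))"

text \<open>The operator \<open>L\<close> with \<open>g(L X, Y) = B(X, Y)\<close>.\<close>

definition op_of_form ::
  "('a::topological_space, 'e::euclidean_space, 'i, 'b::euclidean_space) foliated \<Rightarrow>
   ('a vfield \<Rightarrow> 'a vfield \<Rightarrow> 'a \<Rightarrow> real) \<Rightarrow> 'a vfield \<Rightarrow> 'a vfield" where
  "op_of_form M B X = (\<lambda>p. THE w. w \<in> tangent_space (atlas M) p \<and>
     (\<forall>Y. smooth_vf_near (atlas M) p Y \<longrightarrow> metric M p w (Y p) = B X Y p))"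

definition Ric_op ::
  "('a::topological_space, 'e::euclidean_space, 'i, 'b::euclidean_space) foliated \<Rightarrow>
   ('a vfield \<Rightarrow> 'a vfield \<Rightarrow> 'a vfield) \<Rightarrow> (nat \<Rightarrow> 'a vfield) \<Rightarrow> 'a vfield \<Rightarrow> 'a vfield" where
  "Ric_op M C Xf = op_of_form M (ric_hor M C Xf)"

definition metric_adjoint ::
  "('a::topological_space, 'e::euclidean_space, 'i, 'b::euclidean_space) foliated \<Rightarrow>
   ('a vfield \<Rightarrow> 'a vfield) \<Rightarrow> 'a vfield \<Rightarrow> 'a vfield" where
  "metric_adjoint M L = op_of_form M (\<lambda>X Y p. metric M p (X p) (L Y p))"

end

theory Submission
  imports Defs
begin

text \<open>
  Put \<open>T\<close> for the torsion of the Bott connection \<open>\<nabla>\<close>. Since \<open>J\<^sub>A = 0\<close> for horizontal \<open>A\<close>, the curvature of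
  \<open>\<nabla> + J / \<epsilon>\<close> in the directions \<open>A\<close> and \<open>B\<close> exceeds that of \<open>\<nabla>\<close> by \<open>1 / \<epsilon>\<close> times
  \<open>\<nabla>\<^sub>A (J\<^sub>B Y) - J\<^sub>B (\<nabla>\<^sub>A Y) - J\<^bsub>[A,B]\<^esub> Y\<close> (\<open>curvature_adjoint\<close>). Pair this with a horizontal \<open>W\<close> and
  differentiate the identity \<open>g(J\<^sub>B Y, W) = g(B, T(Y, W))\<close> along \<open>A\<close>. In horizontal directions \<open>\<nabla>\<close> is
  metric, on the horizontal bundle because the Levi-Civita connection is, and on the vertical bundle
  because the leaves are totally geodesic (\<open>bott_metric_hor\<close>, \<open>bott_metric_vert\<close>). The result is
  \<open>- g(B, (\<nabla>\<^sub>A T)(W, Y)) + g(T(A, B), T(Y, W))\<close> (\<open>adjoint_correction\<close>); here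
  \<open>T(Y, W)\<close> depends only on the horizontal part of \<open>Y\<close>. For \<open>A = W = X\<^sub>i\<close> the sum over \<open>i\<close> of the first term is
  \<open>- g(B, \<delta>T(Y))\<close>, and that of the second is \<open>g(J\<^sup>2 B, Y)\<close>, by the skew-symmetry of the \<open>J\<^sub>Z\<close> and
  Parseval's identity in the vertical frame (\<open>J_squared_metric\<close>).

  The operators in the theorem are given by definite descriptions, so the identity of forms only
  becomes one of operators once the forms are known to be represented by vectors. For this, the
  curvature of \<open>\<nabla>\<close> and the covariant derivative of \<open>T\<close> are shown to be tensorial in \<open>Y\<close>; a tensorial
  form is determined by its values on the orthonormal frame (\<open>tensor_expand\<close>, \<open>op_of_form\<close>). The
  description defining \<open>J\<^sub>Z X\<close> is resolved in the same way (\<open>J_frame\<close>). All operators are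
  local: the axioms of a connection, applied to products with the indicator function of an open
  set, show that values on that set depend on nothing else (\<open>conn_cong\<close>).
\<close>

section \<open>Calculus of smooth functions\<close>

lemma Ck_on_subset: "Ck_on k S f \<Longrightarrow> S' \<subseteq> S \<Longrightarrow> Ck_on k S' f"
  by (induction k arbitrary: f) (auto intro: continuous_on_subset)

lemma Ck_on_SucD: "Ck_on (Suc k) S f \<Longrightarrow> Ck_on k S f"
proof (induction k arbitrary: f)
  case 0
  then show ?case
    by (auto intro!: continuous_at_imp_continuous_on differentiable_imp_continuous_within)
next
  case (Suc k)
  have "Ck_on k S (\<lambda>x. frechet_derivative f (at x) v)" for v
    by (rule Suc.IH) (use Suc.prems in simp)
  then show ?case using Suc.prems by simp
qed

lemma frechet_derivative_transform_open:
  assumes "open S" "x \<in> S" "\<forall>x\<in>S. f x = g x" "f differentiable (at x)"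
  shows "g differentiable (at x)" "frechet_derivative g (at x) = frechet_derivative f (at x)"
proof -
  have "(f has_derivative frechet_derivative f (at x)) (at x)"
    using assms(4) frechet_derivative_works by blast
  then have *: "(g has_derivative frechet_derivative f (at x)) (at x)"
    by (rule has_derivative_transform_within_open[OF _ assms(1,2)]) (use assms in auto)
  then show "g differentiable (at x)" by (rule differentiableI)
  show "frechet_derivative g (at x) = frechet_derivative f (at x)"
    using frechet_derivative_at[OF *] by simp
qed

lemma Ck_on_cong:
  assumes "open S" "\<forall>x\<in>S. f x = g x" "Ck_on k S f"
  shows "Ck_on k S g"
  using assms(2,3)
proof (induction k arbitrary: f g)
  case 0
  then show ?case by (simp cong: continuous_on_cong)
next
  case (Suc k)
  have "g differentiable (at x)" "frechet_derivative g (at x) = frechet_derivative f (at x)"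
    if "x \<in> S" for x
    using frechet_derivative_transform_open[OF assms(1) that Suc.prems(1)] Suc.prems(2) that by auto
  then show ?case
    using Suc.IH[of "\<lambda>x. frechet_derivative f (at x) v" "\<lambda>x. frechet_derivative g (at x) v" for v]
      Suc.prems(2) by auto
qed

lemma Ck_on_const: "Ck_on k S (\<lambda>_. c)"
proof (induction k arbitrary: c)
  case (Suc k)
  have "frechet_derivative (\<lambda>_. c) (at x) = (\<lambda>_. 0)" for x :: 'a
    using frechet_derivative_at[OF has_derivative_const[of c "at x"]] by simp
  with Suc[of 0] show ?case by simp
qed simp

lemma Ck_on_add:
  assumes "open S" "Ck_on k S f" "Ck_on k S g"
  shows "Ck_on k S (\<lambda>x. f x + g x)"
  using assms(2,3)
proof (induction k arbitrary: f g)
  case 0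
  then show ?case by (simp add: continuous_on_add)
next
  case (Suc k)
  let ?df = "\<lambda>x. frechet_derivative f (at x)" and ?dg = "\<lambda>x. frechet_derivative g (at x)"
  have D: "((\<lambda>x. f x + g x) has_derivative (\<lambda>v. ?df x v + ?dg x v)) (at x)" if "x \<in> S" for x
    using Suc.prems that by (intro has_derivative_add iffD1[OF frechet_derivative_works]) simp_all
  have "frechet_derivative (\<lambda>x. f x + g x) (at x) = (\<lambda>v. ?df x v + ?dg x v)" if "x \<in> S" for x
    using frechet_derivative_at[OF D[OF that]] by simp
  moreover have "Ck_on k S (\<lambda>x. ?df x v + ?dg x v)" for v
    using Suc.prems by (intro Suc.IH) simp_all
  ultimately have "Ck_on k S (\<lambda>x. frechet_derivative (\<lambda>x. f x + g x) (at x) v)" for v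
    by - (rule Ck_on_cong[OF assms(1), of "\<lambda>x. ?df x v + ?dg x v"], simp_all)
  moreover have "(\<lambda>x. f x + g x) differentiable (at x)" if "x \<in> S" for x
    using D[OF that] by (rule differentiableI)
  ultimately show ?case by simp
qed

lemma Ck_on_mult:
  fixes f g :: "'e::euclidean_space \<Rightarrow> real"
  assumes "open S" "Ck_on k S f" "Ck_on k S g"
  shows "Ck_on k S (\<lambda>x. f x * g x)"
  using assms(2,3)
proof (induction k arbitrary: f g)
  case 0
  then show ?case by (simp add: continuous_on_mult)
next
  case (Suc k)
  let ?df = "\<lambda>x. frechet_derivative f (at x)" and ?dg = "\<lambda>x. frechet_derivative g (at x)"
  have D: "((\<lambda>x. f x * g x) has_derivative (\<lambda>v. f x * ?dg x v + ?df x v * g x)) (at x)"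
    if "x \<in> S" for x
    using Suc.prems that by (intro has_derivative_mult iffD1[OF frechet_derivative_works]) simp_all
  have "frechet_derivative (\<lambda>x. f x * g x) (at x) = (\<lambda>v. f x * ?dg x v + ?df x v * g x)"
    if "x \<in> S" for x
    using frechet_derivative_at[OF D[OF that]] by simp
  moreover have "Ck_on k S (\<lambda>x. f x * ?dg x v + ?df x v * g x)" for v
    using Suc.prems[THEN Ck_on_SucD] Suc.prems
    by (intro Ck_on_add[OF assms(1)] Suc.IH) simp_all
  ultimately have "Ck_on k S (\<lambda>x. frechet_derivative (\<lambda>x. f x * g x) (at x) v)" for v
    by - (rule Ck_on_cong[OF assms(1), of "\<lambda>x. f x * ?dg x v + ?df x v * g x"], simp_all)
  moreover have "(\<lambda>x. f x * g x) differentiable (at x)" if "x \<in> S" for x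
    using D[OF that] by (rule differentiableI)
  ultimately show ?case by simp
qed

lemma smooth_on_subset: "smooth_on A W f \<Longrightarrow> W' \<subseteq> W \<Longrightarrow> smooth_on A W' f"
  unfolding smooth_on_def eucl_smooth_on_def
proof (clarsimp, goal_cases)
  case (1 U \<phi> k)
  then have "Ck_on k (\<phi> ` (U \<inter> W)) (f \<circ> inv_into U \<phi>)" by auto
  then show ?case by (rule Ck_on_subset) (use 1 in blast)
qed

lemma smooth_on_const: "smooth_on A W (\<lambda>_. c)"
  unfolding smooth_on_def eucl_smooth_on_def by (auto simp: comp_def Ck_on_const)

lemma smooth_vf_subset: "smooth_vf A V X \<Longrightarrow> V' \<subseteq> V \<Longrightarrow> smooth_vf A V' X"
  unfolding smooth_vf_def by (meson order_trans subsetD)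

text \<open>A smooth manifold with its atlas; the manifold is the whole type.\<close>

locale smooth_manifold =
  fixes A :: "('a::{t2_space,second_countable_topology}, 'e::euclidean_space) chart set"
  assumes atlas: "smooth_atlas A"
begin

lemma chart_image:
  assumes "(U, \<phi>) \<in> A" "open W"
  shows "open (\<phi> ` (U \<inter> W))" "y \<in> \<phi> ` (U \<inter> W) \<Longrightarrow> inv_into U \<phi> y \<in> W"
proof -
  have h: "homeomorphism U (\<phi> ` U) \<phi> (inv_into U \<phi>)" "open U" "open (\<phi> ` U)"
    using atlas assms(1) unfolding smooth_atlas_def by auto
  have "openin (top_of_set (\<phi> ` U)) (\<phi> ` (U \<inter> W))"
    by (rule homeomorphism_imp_open_map[OF h(1)]) (rule openin_open_Int[OF assms(2)])
  then show "open (\<phi> ` (U \<inter> W))"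
    using h(3) by (rule openin_open_trans)
  have "inj_on \<phi> U"
    by (rule inj_on_inverseI[of _ "inv_into U \<phi>"]) (use h(1) in \<open>auto simp: homeomorphism_def\<close>)
  then show "y \<in> \<phi> ` (U \<inter> W) \<Longrightarrow> inv_into U \<phi> y \<in> W"
    by auto
qed

lemma smooth_on_cong:
  assumes "open W" "\<And>q. q \<in> W \<Longrightarrow> f q = g q" "smooth_on A W f"
  shows "smooth_on A W g"
  unfolding smooth_on_def eucl_smooth_on_def
proof (clarsimp, goal_cases)
  case (1 U \<phi> k)
  show ?case
  proof (rule Ck_on_cong)
    show "open (\<phi> ` (U \<inter> W))" using chart_image 1 assms by blast
    show "Ck_on k (\<phi> ` (U \<inter> W)) (f \<circ> inv_into U \<phi>)"
      using assms(3) 1 unfolding smooth_on_def eucl_smooth_on_def by auto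
    show "\<forall>x\<in>\<phi> ` (U \<inter> W). (f \<circ> inv_into U \<phi>) x = (g \<circ> inv_into U \<phi>) x"
      using chart_image(2)[OF 1 assms(1)] assms(2) by simp
  qed
qed

lemma smooth_on_add:
  assumes "open W" "smooth_on A W f" "smooth_on A W g"
  shows "smooth_on A W (\<lambda>q. f q + g q)"
  unfolding smooth_on_def eucl_smooth_on_def
proof (clarsimp, goal_cases)
  case (1 U \<phi> k)
  have "Ck_on k (\<phi> ` (U \<inter> W)) (f \<circ> inv_into U \<phi>)" "Ck_on k (\<phi> ` (U \<inter> W)) (g \<circ> inv_into U \<phi>)"
    using assms(2,3) 1 unfolding smooth_on_def eucl_smooth_on_def by auto
  from Ck_on_add[OF chart_image(1)[OF 1 assms(1)] this] show ?case by (simp add: comp_def)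
qed

lemma smooth_on_mult:
  fixes f g :: "'a \<Rightarrow> real"
  assumes "open W" "smooth_on A W f" "smooth_on A W g"
  shows "smooth_on A W (\<lambda>q. f q * g q)"
  unfolding smooth_on_def eucl_smooth_on_def
proof (clarsimp, goal_cases)
  case (1 U \<phi> k)
  have "Ck_on k (\<phi> ` (U \<inter> W)) (f \<circ> inv_into U \<phi>)" "Ck_on k (\<phi> ` (U \<inter> W)) (g \<circ> inv_into U \<phi>)"
    using assms(2,3) 1 unfolding smooth_on_def eucl_smooth_on_def by auto
  from Ck_on_mult[OF chart_image(1)[OF 1 assms(1)] this] show ?case by (simp add: comp_def)
qed

lemma smooth_nearI: "open W \<Longrightarrow> p \<in> W \<Longrightarrow> smooth_on A W f \<Longrightarrow> smooth_near A p f"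
  unfolding smooth_near_def by blast

lemma smooth_near_cong:
  assumes "open W" "p \<in> W" "\<And>q. q \<in> W \<Longrightarrow> f q = g q"
  shows "smooth_near A p f \<longleftrightarrow> smooth_near A p g"
proof -
  have "smooth_near A p g" if "smooth_near A p f" "\<And>q. q \<in> W \<Longrightarrow> f q = g q" for f g
  proof -
    obtain W' where "open W'" "p \<in> W'" "smooth_on A W' f"
      using \<open>smooth_near A p f\<close> unfolding smooth_near_def by blast
    then have "smooth_on A (W \<inter> W') f" "open (W \<inter> W')" using assms(1)
      by (auto intro: smooth_on_subset)
    then have "smooth_on A (W \<inter> W') g"
      using smooth_on_cong[of "W \<inter> W'" f g] that(2) by auto
    then show ?thesis
      using \<open>open (W \<inter> W')\<close> \<open>p \<in> W'\<close> assms(2) by (intro smooth_nearI[of "W \<inter> W'"]) auto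
  qed
  from this[of f g] this[of g f] show ?thesis using assms(3) by auto
qed

lemma smooth_near_const: "smooth_near A p (\<lambda>_. c)"
  by (rule smooth_nearI[of UNIV]) (auto simp: smooth_on_const)

lemma
  assumes "smooth_near A p f" "smooth_near A p g"
  shows smooth_near_add: "smooth_near A p (\<lambda>q. f q + g q)"
    and smooth_near_mult: "smooth_near A p (\<lambda>q. f q * g q)"
proof -
  obtain W W' where "open W" "p \<in> W" "smooth_on A W f" "open W'" "p \<in> W'" "smooth_on A W' g"
    using assms unfolding smooth_near_def by blast
  then have *: "open (W \<inter> W')" "p \<in> W \<inter> W'" "smooth_on A (W \<inter> W') f" "smooth_on A (W \<inter> W') g"
    by (auto intro: smooth_on_subset)
  show "smooth_near A p (\<lambda>q. f q + g q)" "smooth_near A p (\<lambda>q. f q * g q)"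
    using * by (auto intro!: smooth_nearI[OF *(1,2)] smooth_on_add smooth_on_mult)
qed

lemma smooth_near_scale: "smooth_near A p f \<Longrightarrow> smooth_near A p (\<lambda>q. c * f q)"
  using smooth_near_mult[OF smooth_near_const] .


section \<open>Tangent vectors and vector fields\<close>

lemma tvec_add:
  "v \<in> tangent_space A p \<Longrightarrow> smooth_near A p f \<Longrightarrow> smooth_near A p h \<Longrightarrow>
   v (\<lambda>q. f q + h q) = v f + v h"
  unfolding tangent_space_def by (auto simp: plus_fun_def)

lemma tvec_mult:
  "v \<in> tangent_space A p \<Longrightarrow> smooth_near A p f \<Longrightarrow> smooth_near A p h \<Longrightarrow>
   v (\<lambda>q. f q * h q) = v f * h p + f p * v h"
  unfolding tangent_space_def by (auto simp: times_fun_def)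

lemma tvec_scale: "v \<in> tangent_space A p \<Longrightarrow> smooth_near A p f \<Longrightarrow> v (\<lambda>q. c * f q) = c * v f"
  unfolding tangent_space_def by auto

lemma tvec_not_smooth: "v \<in> tangent_space A p \<Longrightarrow> \<not> smooth_near A p f \<Longrightarrow> v f = 0"
  unfolding tangent_space_def by auto

lemma tvec_zero: "v \<in> tangent_space A p \<Longrightarrow> v (\<lambda>_. 0) = 0"
  using tvec_scale[OF _ smooth_near_const, of v p 0 0] by simp

text \<open>Germs: \<open>f - g\<close> is unchanged by multiplication with the indicator function of the complement
  of \<open>W\<close>, and both factors vanish at \<open>p\<close>.\<close>

lemma tvec_local:
  assumes v: "v \<in> tangent_space A p" and W: "open W" "p \<in> W" "\<And>q. q \<in> W \<Longrightarrow> f q = g q"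
  shows "v f = v g"
proof (cases "smooth_near A p f")
  case False
  then show ?thesis
    using tvec_not_smooth[OF v, of f] tvec_not_smooth[OF v, of g] smooth_near_cong[OF W(1,2), of f g] W(3)
    by auto
next
  case f: True
  then have g: "smooth_near A p g" using smooth_near_cong[OF W(1,2), of f g] W(3) by auto
  let ?d = "\<lambda>q. f q + (-1) * g q" and ?i = "\<lambda>q. if q \<in> W then 0 else 1::real"
  have d: "smooth_near A p ?d" by (intro smooth_near_add f smooth_near_scale g)
  have i: "smooth_near A p ?i"
    using smooth_near_const[of p 0] smooth_near_cong[OF W(1,2), of ?i "\<lambda>_. 0"] by simp
  have "v ?d = v (\<lambda>q. ?d q * ?i q)"
    by (rule arg_cong[where f=v]) (use W(3) in auto)
  also have "\<dots> = 0"
    using tvec_mult[OF v d i] W by simp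
  finally have "v ?d = 0" .
  moreover have "v ?d = v f + v (\<lambda>q. (-1) * g q)"
    by (rule tvec_add[OF v f smooth_near_scale[OF g]])
  moreover have "v (\<lambda>q. (-1) * g q) = -1 * v g" by (rule tvec_scale[OF v g])
  ultimately show ?thesis by linarith
qed

text \<open>An indicator function is idempotent, so the Leibniz rule at a point where it equals \<open>1\<close>
  gives \<open>v 1\<^sub>W = 2 * v 1\<^sub>W\<close>.\<close>

lemma tvec_indicator:
  assumes "v \<in> tangent_space A p" "open W" "p \<in> W"
  shows "v (indicator W) = 0"
proof -
  have i: "smooth_near A p (indicator W)"
    using smooth_near_const[of p 1] smooth_near_cong[OF assms(2,3), of "indicator W" "\<lambda>_. 1"] by simp
  have "v (indicator W) = v (\<lambda>q. indicator W q * indicator W q)"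
    by (rule arg_cong[where f=v]) (auto simp: indicator_def)
  then show ?thesis using tvec_mult[OF assms(1) i i] assms(3) by simp
qed

lemma tvec_const: "v \<in> tangent_space A p \<Longrightarrow> v (\<lambda>_. c) = 0"
  using tvec_mult[of v p "\<lambda>_. 1" "\<lambda>_. 1"] tvec_scale[of v p "\<lambda>_. 1" c] by (simp add: smooth_near_const)

lemma tangent_zero: "0 \<in> tangent_space A p"
  unfolding tangent_space_def by simp

lemma tangent_add: "u \<in> tangent_space A p \<Longrightarrow> v \<in> tangent_space A p \<Longrightarrow> u + v \<in> tangent_space A p"
  unfolding tangent_space_def by (auto simp: algebra_simps)

lemma tangent_scale: "v \<in> tangent_space A p \<Longrightarrow> c \<cdot>\<^sub>t v \<in> tangent_space A p"
  unfolding tangent_space_def tscale_def by (auto simp: algebra_simps)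

lemma tangent_minus: "u \<in> tangent_space A p \<Longrightarrow> v \<in> tangent_space A p \<Longrightarrow> u - v \<in> tangent_space A p"
  unfolding tangent_space_def by (auto simp: algebra_simps)

lemma tangent_uminus: "v \<in> tangent_space A p \<Longrightarrow> - v \<in> tangent_space A p"
  unfolding tangent_space_def by (auto simp: algebra_simps fun_Compl_def)

lemma tangent_sum:
  "(\<And>i. i \<in> I \<Longrightarrow> F i \<in> tangent_space A p) \<Longrightarrow> (\<Sum>i\<in>I. F i) \<in> tangent_space A p"
  by (induction I rule: infinite_finite_induct) (auto intro: tangent_add simp: tangent_zero)

end

text \<open>An open set \<open>V\<close>; the calculus of the functions and the vector fields that are smooth on
  it.\<close>

locale manifold_region = smooth_manifold A
  for A :: "('a::{t2_space,second_countable_topology}, 'e::euclidean_space) chart set" +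
  fixes V :: "'a set"
  assumes openV: "open V"
begin

abbreviation "vf \<equiv> smooth_vf A V"
abbreviation "sf \<equiv> (smooth_on A V :: ('a \<Rightarrow> real) \<Rightarrow> bool)"
abbreviation "T \<equiv> tangent_space A"
abbreviation "br \<equiv> lie_bracket A"

lemma vf_tangent: "vf X \<Longrightarrow> q \<in> V \<Longrightarrow> X q \<in> T q"
  unfolding smooth_vf_def by auto

lemma vf_deriv: "vf X \<Longrightarrow> sf f \<Longrightarrow> sf (\<lambda>q. X q f)"
  using openV unfolding smooth_vf_def by auto

lemma vf_deriv': "vf X \<Longrightarrow> open W \<Longrightarrow> W \<subseteq> V \<Longrightarrow> smooth_on A W f \<Longrightarrow> smooth_on A W (\<lambda>q. X q f)"
  unfolding smooth_vf_def by auto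

lemma sf_near: "sf f \<Longrightarrow> q \<in> V \<Longrightarrow> smooth_near A q f"
  using smooth_nearI[OF openV] .

lemma vf_deriv_near: "vf X \<Longrightarrow> q \<in> V \<Longrightarrow> smooth_near A q f \<Longrightarrow> smooth_near A q (\<lambda>q. X q f)"
proof -
  assume a: "vf X" "q \<in> V" "smooth_near A q f"
  then obtain W where W: "open W" "q \<in> W" "smooth_on A W f" unfolding smooth_near_def by blast
  show ?thesis
    using a W openV
    by (intro smooth_nearI[of "V \<inter> W"] vf_deriv'[OF a(1)]) (auto intro: smooth_on_subset)
qed

lemma tvec_cong: "v \<in> T q \<Longrightarrow> q \<in> V \<Longrightarrow> (\<And>r. r \<in> V \<Longrightarrow> f r = h r) \<Longrightarrow> v f = v h"
  using tvec_local[OF _ openV] by blast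

lemma vfI:
  assumes "\<And>q. q \<in> V \<Longrightarrow> X q \<in> T q"
    and "\<And>W f. open W \<Longrightarrow> W \<subseteq> V \<Longrightarrow> smooth_on A W f \<Longrightarrow> smooth_on A W (\<lambda>q. X q f)"
  shows "vf X"
  using assms unfolding smooth_vf_def by simp

lemma vf_cong:
  assumes X: "vf X" and eq: "\<And>q. q \<in> V \<Longrightarrow> X q = Y q"
  shows "vf Y"
proof (rule vfI)
  show "Y q \<in> T q" if "q \<in> V" for q using vf_tangent[OF X that] eq[OF that] by simp
  show "smooth_on A W (\<lambda>q. Y q f)" if W: "open W" "W \<subseteq> V" "smooth_on A W f" for W f
    by (rule smooth_on_cong[OF W(1) _ vf_deriv'[OF X W]]) (use W(2) eq in auto)
qed

lemma vf_zero: "vf 0"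
  by (rule vfI) (simp_all add: tangent_zero smooth_on_const)

lemma vf_add: "vf X \<Longrightarrow> vf Y \<Longrightarrow> vf (X + Y)"
  by (rule vfI) (simp_all add: tangent_add vf_tangent smooth_on_add vf_deriv')

lemma fscale_apply: "(f \<cdot>\<^sub>f X) q = f q \<cdot>\<^sub>t X q"
  unfolding fscale_def ..

lemma tscale_apply: "(c \<cdot>\<^sub>t v) f = c * v f"
  unfolding tscale_def ..

lemma vf_fscale: "sf f \<Longrightarrow> vf X \<Longrightarrow> vf (f \<cdot>\<^sub>f X)"
  by (rule vfI)
    (simp_all add: fscale_apply tscale_apply tangent_scale vf_tangent smooth_on_mult vf_deriv'
      smooth_on_subset)

lemma sf_indicator: "sf (indicator V)"
  by (rule smooth_on_cong[OF openV _ smooth_on_const[of A V 1]]) auto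

lemma vf_uminus: "vf X \<Longrightarrow> vf (- X)"
  using vf_fscale[OF smooth_on_const[of A V "-1"], of X]
  by (rule vf_cong) (auto simp: fscale_apply tscale_def fun_eq_iff)

lemma vf_minus: "vf X \<Longrightarrow> vf Y \<Longrightarrow> vf (X - Y)"
  using vf_add[OF _ vf_uminus, of X Y] by simp

lemma vf_sum: "(\<And>i. i \<in> I \<Longrightarrow> vf (F i)) \<Longrightarrow> vf (\<Sum>i\<in>I. F i)"
  by (induction I rule: infinite_finite_induct) (auto intro: vf_add vf_zero)

lemma br_apply: "smooth_near A q f \<Longrightarrow> br X Y q f = X q (\<lambda>r. Y r f) - Y q (\<lambda>r. X r f)"
  unfolding lie_bracket_def by simp

lemma br_not_smooth: "\<not> smooth_near A q f \<Longrightarrow> br X Y q f = 0"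
  unfolding lie_bracket_def by simp

lemma br_tangent:
  assumes X: "vf X" and Y: "vf Y" and q: "q \<in> V"
  shows "br X Y q \<in> T q"
proof -
  note t = vf_tangent[OF X q] vf_tangent[OF Y q]
  note d = vf_deriv_near[OF X q] vf_deriv_near[OF Y q]
  have add: "br X Y q (\<lambda>r. f r + h r) = br X Y q f + br X Y q h" (is ?add) and
    mult: "br X Y q (\<lambda>r. f r * h r) = br X Y q f * h q + f q * br X Y q h" (is ?mult)
    if f: "smooth_near A q f" and h: "smooth_near A q h" for f h
  proof -
    obtain W W' where W: "open W" "q \<in> W" "smooth_on A W f" "open W'" "q \<in> W'" "smooth_on A W' h"
      using f h unfolding smooth_near_def by blast
    let ?W = "V \<inter> W \<inter> W'"
    have W': "open ?W" "q \<in> ?W" using W openV q by auto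
    have n: "smooth_near A r f" "smooth_near A r h" if "r \<in> ?W" for r
      using W that by (auto intro: smooth_nearI)
    have 1: "X q (\<lambda>r. Y r (\<lambda>r. f r + h r)) = X q (\<lambda>r. Y r f + Y r h)"
      by (rule tvec_local[OF t(1) W']) (rule tvec_add[OF vf_tangent[OF Y] n], auto)
    have 2: "Y q (\<lambda>r. X r (\<lambda>r. f r + h r)) = Y q (\<lambda>r. X r f + X r h)"
      by (rule tvec_local[OF t(2) W']) (rule tvec_add[OF vf_tangent[OF X] n], auto)
    show ?add
      unfolding br_apply[OF f] br_apply[OF h] br_apply[OF smooth_near_add[OF f h]] 1 2
      using tvec_add[OF t(1) d(2)[OF f] d(2)[OF h]] tvec_add[OF t(2) d(1)[OF f] d(1)[OF h]]
      by simp
    have 3: "X q (\<lambda>r. Y r (\<lambda>r. f r * h r)) = X q (\<lambda>r. Y r f * h r + f r * Y r h)"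
      by (rule tvec_local[OF t(1) W']) (rule tvec_mult[OF vf_tangent[OF Y] n], auto)
    have 4: "Y q (\<lambda>r. X r (\<lambda>r. f r * h r)) = Y q (\<lambda>r. X r f * h r + f r * X r h)"
      by (rule tvec_local[OF t(2) W']) (rule tvec_mult[OF vf_tangent[OF X] n], auto)
    show ?mult
      unfolding br_apply[OF f] br_apply[OF h] br_apply[OF smooth_near_mult[OF f h]] 3 4
      using tvec_add[OF t(1) smooth_near_mult[OF d(2)[OF f] h] smooth_near_mult[OF f d(2)[OF h]]]
        tvec_add[OF t(2) smooth_near_mult[OF d(1)[OF f] h] smooth_near_mult[OF f d(1)[OF h]]]
        tvec_mult[OF t(1) d(2)[OF f] h] tvec_mult[OF t(1) f d(2)[OF h]]
        tvec_mult[OF t(2) d(1)[OF f] h] tvec_mult[OF t(2) f d(1)[OF h]]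
      by (simp add: algebra_simps)
  qed
  have "br X Y q (\<lambda>_. c) = 0" for c
  proof -
    have "X q (\<lambda>r. Y r (\<lambda>_. c)) = X q (\<lambda>_. 0)" "Y q (\<lambda>r. X r (\<lambda>_. c)) = Y q (\<lambda>_. 0)"
      by (rule tvec_cong[OF t(1) q], rule tvec_const, rule vf_tangent[OF Y], assumption)
        (rule tvec_cong[OF t(2) q], rule tvec_const, rule vf_tangent[OF X], assumption)
    then show ?thesis by (simp add: br_apply smooth_near_const tvec_zero[OF t(1)] tvec_zero[OF t(2)])
  qed
  then have scale: "br X Y q (\<lambda>r. c * f r) = c * br X Y q f" if "smooth_near A q f" for f c
    using mult[OF smooth_near_const[of q c] that] by simp
  show ?thesis
    unfolding tangent_space_def using add mult scale
    by (auto simp: plus_fun_def times_fun_def br_not_smooth)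
qed


lemma vf_br:
  assumes X: "vf X" and Y: "vf Y"
  shows "vf (br X Y)"
proof (rule vfI)
  show "br X Y q \<in> T q" if "q \<in> V" for q using br_tangent[OF X Y that] .
  fix W and f :: "'a \<Rightarrow> real"
  assume W: "open W" "W \<subseteq> V" "smooth_on A W f"
  have "smooth_on A W (\<lambda>q. X q (\<lambda>r. Y r f) + (-1) * Y q (\<lambda>r. X r f))"
    by (intro smooth_on_add smooth_on_mult smooth_on_const vf_deriv'[OF X] vf_deriv'[OF Y] W)
  then show "smooth_on A W (\<lambda>q. br X Y q f)"
    by (rule smooth_on_cong[OF W(1), rotated])
      (simp add: br_apply smooth_nearI[OF W(1) _ W(3)])
qed

lemma br_cong:
  assumes X: "vf X" and Y: "vf Y" and q: "q \<in> V"
    and eq: "\<And>r. r \<in> V \<Longrightarrow> X r = X' r" "\<And>r. r \<in> V \<Longrightarrow> Y r = Y' r"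
  shows "br X Y q = br X' Y' q"
proof
  fix f
  have "X q (\<lambda>r. Y r f) = X q (\<lambda>r. Y' r f)" "Y q (\<lambda>r. X r f) = Y q (\<lambda>r. X' r f)"
    by (rule tvec_cong[OF vf_tangent[OF X q] q], simp add: eq)
      (rule tvec_cong[OF vf_tangent[OF Y q] q], simp add: eq)
  then show "br X Y q f = br X' Y' q f"
    unfolding lie_bracket_def using eq[OF q] by simp
qed

lemma br_anti: "br Y X q = - br X Y q"
  unfolding lie_bracket_def by (auto simp: fun_eq_iff)

lemma br_add_right:
  assumes "vf X" "vf Y" "vf Y'" "q \<in> V"
  shows "br X (Y + Y') q = br X Y q + br X Y' q"
proof
  fix f
  show "br X (Y + Y') q f = (br X Y q + br X Y' q) f"
  proof (cases "smooth_near A q f")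
    case True
    then show ?thesis
      using tvec_add[OF vf_tangent[OF assms(1,4)] vf_deriv_near[OF assms(2,4) True]
          vf_deriv_near[OF assms(3,4) True]]
      by (simp add: br_apply algebra_simps)
  qed (simp add: br_not_smooth)
qed

lemma br_fscale_right:
  assumes "vf X" "vf Y" "sf h" "q \<in> V"
  shows "br X (h \<cdot>\<^sub>f Y) q = X q h \<cdot>\<^sub>t Y q + h q \<cdot>\<^sub>t br X Y q"
proof
  fix f
  show "br X (h \<cdot>\<^sub>f Y) q f = (X q h \<cdot>\<^sub>t Y q + h q \<cdot>\<^sub>t br X Y q) f"
  proof (cases "smooth_near A q f")
    case True
    then show ?thesis
      using tvec_mult[OF vf_tangent[OF assms(1,4)] sf_near[OF assms(3,4)]
          vf_deriv_near[OF assms(2,4) True]]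
      by (simp add: br_apply fscale_apply tscale_apply algebra_simps)
  next
    case False
    then show ?thesis
      using tvec_not_smooth[OF vf_tangent[OF assms(2,4)]]
      by (simp add: br_not_smooth tscale_apply)
  qed
qed

lemma br_add_left:
  assumes "vf X" "vf X'" "vf Y" "q \<in> V"
  shows "br (X + X') Y q = br X Y q + br X' Y q"
  using br_add_right[OF assms(3,1,2,4)] by (simp add: br_anti[of _ Y])

lemma br_fscale_left:
  assumes "vf X" "vf Y" "sf h" "q \<in> V"
  shows "br (h \<cdot>\<^sub>f X) Y q = h q \<cdot>\<^sub>t br X Y q - Y q h \<cdot>\<^sub>t X q"
  using br_fscale_right[OF assms(2,1,3,4)]
  by (simp add: br_anti[of _ Y]) (simp add: fun_eq_iff tscale_apply)

end


section \<open>Connections on an open set\<close>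

text \<open>The connection axioms for the fields that are smooth on one open set \<open>V\<close>; nothing is asked
  of the values of \<open>C X Y\<close> outside \<open>V\<close>.\<close>

locale connection_on = manifold_region A V
  for A :: "('a::{t2_space,second_countable_topology}, 'e::euclidean_space) chart set" and V +
  fixes C :: "'a vfield \<Rightarrow> 'a vfield \<Rightarrow> 'a vfield"
  assumes vf_conn: "vf X \<Longrightarrow> vf Y \<Longrightarrow> vf (C X Y)"
    and conn_add_left: "vf X \<Longrightarrow> vf X' \<Longrightarrow> vf Y \<Longrightarrow> q \<in> V \<Longrightarrow> C (X + X') Y q = C X Y q + C X' Y q"
    and conn_fscale_left: "vf X \<Longrightarrow> vf Y \<Longrightarrow> sf f \<Longrightarrow> q \<in> V \<Longrightarrow> C (f \<cdot>\<^sub>f X) Y q = f q \<cdot>\<^sub>t C X Y q"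
    and conn_add_right: "vf X \<Longrightarrow> vf Y \<Longrightarrow> vf Y' \<Longrightarrow> q \<in> V \<Longrightarrow> C X (Y + Y') q = C X Y q + C X Y' q"
    and conn_leibniz: "vf X \<Longrightarrow> vf Y \<Longrightarrow> sf f \<Longrightarrow> q \<in> V \<Longrightarrow>
      C X (f \<cdot>\<^sub>f Y) q = X q f \<cdot>\<^sub>t Y q + f q \<cdot>\<^sub>t C X Y q"
begin

text \<open>Multiplying a field by the indicator function of \<open>V\<close> makes it independent of the values
  outside \<open>V\<close> and, by the axioms, does not change \<open>C\<close> on \<open>V\<close>.\<close>

lemma conn_cong:
  assumes X: "vf X" and Y: "vf Y" and q: "q \<in> V"
    and eq: "\<And>r. r \<in> V \<Longrightarrow> X r = X' r" "\<And>r. r \<in> V \<Longrightarrow> Y r = Y' r"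
  shows "C X Y q = C X' Y' q"
proof -
  let ?i = "indicator V :: 'a \<Rightarrow> real"
  have X': "vf X'" and Y': "vf Y'"
    using vf_cong[OF X, of X'] vf_cong[OF Y, of Y'] eq by auto
  have ix: "?i \<cdot>\<^sub>f X = ?i \<cdot>\<^sub>f X'" and iy: "?i \<cdot>\<^sub>f Y = ?i \<cdot>\<^sub>f Y'"
    using eq by (auto simp: fscale_def tscale_def fun_eq_iff indicator_def)
  have 1: "C (?i \<cdot>\<^sub>f X) Y q = C X Y q" if "vf X" for X
    using conn_fscale_left[OF that Y sf_indicator q] q by (simp add: tscale_def)
  have 2: "C X' (?i \<cdot>\<^sub>f Y) q = C X' Y q" if "vf Y" for Y
    using conn_leibniz[OF X' that sf_indicator q] q
      tvec_indicator[OF vf_tangent[OF X' q] openV q]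
    by (simp add: tscale_def fun_eq_iff)
  show ?thesis
    using 1[OF X] 1[OF X'] 2[OF Y] 2[OF Y'] ix iy by metis
qed

lemma conn_zero_left: "vf Y \<Longrightarrow> q \<in> V \<Longrightarrow> C 0 Y q = 0"
  using conn_add_left[OF vf_zero vf_zero, of Y q] by simp

lemma conn_uminus_right: 
  assumes "vf X" "vf Y" "q \<in> V"
  shows "C X (- Y) q = - C X Y q"
proof -
  have "C X 0 q = 0" using conn_add_right[OF assms(1) vf_zero vf_zero assms(3)] by simp
  then show ?thesis
    using conn_add_right[OF assms(1,2) vf_uminus[OF assms(2)] assms(3)]
    by (simp add: add_eq_0_iff)
qed

abbreviation "tor \<equiv> torsion A C"
abbreviation "curv \<equiv> curvature A C"

text \<open>The covariant derivative of the torsion tensor.\<close>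

abbreviation "dtor X Y Z \<equiv> C X (tor Y Z) - tor (C X Y) Z - tor Y (C X Z)"

lemma tor_apply: "tor X Y q = C X Y q - C Y X q - br X Y q"
  unfolding torsion_def by simp

lemma tor_anti: "tor Y X q = - tor X Y q"
  by (simp add: tor_apply br_anti[of Y X])

lemma vf_tor: "vf X \<Longrightarrow> vf Y \<Longrightarrow> vf (tor X Y)"
  unfolding torsion_def by (intro vf_minus vf_conn vf_br)

lemma tor_cong:
  assumes "vf X" "vf Y" "q \<in> V" "\<And>r. r \<in> V \<Longrightarrow> X r = X' r" "\<And>r. r \<in> V \<Longrightarrow> Y r = Y' r"
  shows "tor X Y q = tor X' Y' q"
  unfolding tor_apply
  using conn_cong[of X Y q X' Y'] conn_cong[of Y X q Y' X'] br_cong[of X Y q X' Y'] assms by simp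

lemma tor_add_right:
  "vf X \<Longrightarrow> vf Y \<Longrightarrow> vf Y' \<Longrightarrow> q \<in> V \<Longrightarrow> tor X (Y + Y') q = tor X Y q + tor X Y' q"
  by (simp add: tor_apply conn_add_right conn_add_left br_add_right)

lemma tor_fscale_right:
  "vf X \<Longrightarrow> vf Y \<Longrightarrow> sf f \<Longrightarrow> q \<in> V \<Longrightarrow> tor X (f \<cdot>\<^sub>f Y) q = f q \<cdot>\<^sub>t tor X Y q"
  by (simp add: tor_apply conn_leibniz conn_fscale_left br_fscale_right)
    (simp add: fun_eq_iff tscale_apply algebra_simps)

lemma dtor_cong:
  assumes "vf X" "vf Y" "vf Z" "q \<in> V" "\<And>r. r \<in> V \<Longrightarrow> Z r = Z' r"
  shows "dtor X Y Z q = dtor X Y Z' q"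
proof -
  have "tor Y Z r = tor Y Z' r" "C X Z r = C X Z' r" if "r \<in> V" for r
    using tor_cong[OF assms(2,3) that] conn_cong[OF assms(1,3) that] assms(5) by auto
  then show ?thesis
    using conn_cong[OF assms(1) vf_tor[OF assms(2,3)] assms(4), of X "tor Y Z'"]
      tor_cong[OF vf_conn[OF assms(1,2)] assms(3,4), of "C X Y" Z']
      tor_cong[OF assms(2) vf_conn[OF assms(1,3)] assms(4), of Y "C X Z'"] assms(5)
    by simp
qed

lemma dtor_add:
  assumes "vf X" "vf Y" "vf Z" "vf Z'" "q \<in> V"
  shows "dtor X Y (Z + Z') q = dtor X Y Z q + dtor X Y Z' q"
proof -
  note v = assms vf_conn vf_tor vf_add
  have "C X (tor Y (Z + Z')) q = C X (tor Y Z + tor Y Z') q"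
    by (rule conn_cong) (simp_all add: v tor_add_right)
  moreover have "tor Y (C X (Z + Z')) q = tor Y (C X Z + C X Z') q"
    by (rule tor_cong) (simp_all add: v conn_add_right)
  ultimately show ?thesis
    by (simp add: v conn_add_right tor_add_right)
qed

lemma dtor_fscale:
  assumes "vf X" "vf Y" "vf Z" "sf f" "q \<in> V"
  shows "dtor X Y (f \<cdot>\<^sub>f Z) q = f q \<cdot>\<^sub>t dtor X Y Z q"
proof -
  note v = assms vf_conn vf_tor vf_add vf_fscale vf_deriv[OF assms(1)]
  have "C X (tor Y (f \<cdot>\<^sub>f Z)) q = C X (f \<cdot>\<^sub>f tor Y Z) q"
    by (rule conn_cong) (simp_all add: v tor_fscale_right fscale_apply)
  moreover have "tor Y (C X (f \<cdot>\<^sub>f Z)) q = tor Y ((\<lambda>q. X q f) \<cdot>\<^sub>f Z + f \<cdot>\<^sub>f C X Z) q"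
    by (rule tor_cong) (simp_all add: v conn_leibniz fscale_apply)
  ultimately show ?thesis
    by (simp add: v conn_leibniz tor_add_right tor_fscale_right)
      (simp add: fun_eq_iff tscale_apply algebra_simps)
qed

lemma curv_apply: "curv X Y Z q = C X (C Y Z) q - C Y (C X Z) q - C (br X Y) Z q"
  unfolding curvature_def by simp

lemma vf_curv: "vf X \<Longrightarrow> vf Y \<Longrightarrow> vf Z \<Longrightarrow> vf (curv X Y Z)"
  unfolding curvature_def by (intro vf_minus vf_conn vf_br)

lemma curv_cong:
  assumes "vf X" "vf Y" "vf Z" "q \<in> V" "\<And>r. r \<in> V \<Longrightarrow> Z r = Z' r"
  shows "curv X Y Z q = curv X Y Z' q"
proof -
  have "C Y Z r = C Y Z' r" "C X Z r = C X Z' r" if "r \<in> V" for r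
    using conn_cong[OF assms(1,3) that] conn_cong[OF assms(2,3) that] assms(5) by auto
  then show ?thesis
    using conn_cong[OF assms(1) vf_conn[OF assms(2,3)] assms(4), of X "C Y Z'"]
      conn_cong[OF assms(2) vf_conn[OF assms(1,3)] assms(4), of Y "C X Z'"]
      conn_cong[OF vf_br[OF assms(1,2)] assms(3,4), of "br X Y" Z'] assms(5)
    by (simp add: curv_apply)
qed

lemma curv_add:
  assumes "vf X" "vf Y" "vf Z" "vf Z'" "q \<in> V"
  shows "curv X Y (Z + Z') q = curv X Y Z q + curv X Y Z' q"
proof -
  note v = assms vf_conn vf_add vf_br
  have "C X (C Y (Z + Z')) q = C X (C Y Z + C Y Z') q"
    by (rule conn_cong) (simp_all add: v conn_add_right)
  moreover have "C Y (C X (Z + Z')) q = C Y (C X Z + C X Z') q"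
    by (rule conn_cong) (simp_all add: v conn_add_right)
  ultimately show ?thesis
    by (simp add: v curv_apply conn_add_right)
qed

lemma curv_fscale:
  assumes "vf X" "vf Y" "vf Z" "sf f" "q \<in> V"
  shows "curv X Y (f \<cdot>\<^sub>f Z) q = f q \<cdot>\<^sub>t curv X Y Z q"
proof -
  note v = assms vf_conn vf_add vf_br vf_fscale vf_deriv[OF assms(1)] vf_deriv[OF assms(2)]
  have "C X (C Y (f \<cdot>\<^sub>f Z)) q = C X ((\<lambda>q. Y q f) \<cdot>\<^sub>f Z + f \<cdot>\<^sub>f C Y Z) q"
    by (rule conn_cong) (simp_all add: v conn_leibniz fscale_apply)
  moreover have "C Y (C X (f \<cdot>\<^sub>f Z)) q = C Y ((\<lambda>q. X q f) \<cdot>\<^sub>f Z + f \<cdot>\<^sub>f C X Z) q"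
    by (rule conn_cong) (simp_all add: v conn_leibniz fscale_apply)
  moreover have "br X Y q f = X q (\<lambda>r. Y r f) - Y q (\<lambda>r. X r f)"
    by (rule br_apply[OF sf_near[OF assms(4,5)]])
  ultimately show ?thesis
    by (simp add: v curv_apply conn_add_right conn_leibniz)
      (simp add: fun_eq_iff tscale_apply algebra_simps)
qed

end

section \<open>The horizontal and vertical projections in an adapted frame\<close>

text \<open>The vertical and the horizontal part of a single tangent vector, that is, the projections of
  fields evaluated at a point.\<close>

definition vert_part ::
  "('a::topological_space, 'e::euclidean_space, 'i, 'b::euclidean_space) foliated \<Rightarrow> 'a \<Rightarrow> 'a tvec \<Rightarrow> 'a tvec" where
  "vert_part M q v = (THE w. w \<in> vert M q \<and> v - w \<in> hor M q)"

definition hor_part ::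
  "('a::topological_space, 'e::euclidean_space, 'i, 'b::euclidean_space) foliated \<Rightarrow> 'a \<Rightarrow> 'a tvec \<Rightarrow> 'a tvec" where
  "hor_part M q v = (THE u. u \<in> hor M q \<and> v - u \<in> vert M q)"

lemma proj_vert_apply: "proj_vert M X q = vert_part M q (X q)"
  unfolding proj_vert_def vert_part_def ..

lemma proj_hor_apply: "proj_hor M X q = hor_part M q (X q)"
  unfolding proj_hor_def hor_part_def ..

text \<open>A Riemannian manifold with Levi-Civita connection \<open>D\<close>, a vertical distribution with totally
  geodesic leaves, and an open set \<open>V\<close> that carries orthonormal frames of the horizontal and of the
  vertical bundle.\<close>

locale framed_foliation = manifold_region "atlas M" V
  for M :: "('a::{t2_space,second_countable_topology}, 'e::euclidean_space, 'i,
             'b::euclidean_space) foliated" and V +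
  fixes D :: "'a vfield \<Rightarrow> 'a vfield \<Rightarrow> 'a vfield"
    and m :: nat
    and Xf Zf :: "nat \<Rightarrow> 'a vfield"
  assumes metric: "riemannian_metric (atlas M) (metric M)"
    and levi_civita: "levi_civita (atlas M) (metric M) D"
    and tot_geodesic: "totally_geodesic_leaves M D"
    and frame_hor: "orthonormal_frame M (hor M) DIM('b) V Xf"
    and frame_vert: "orthonormal_frame M (vert M) m V Zf"
begin

abbreviation "g \<equiv> metric M"
abbreviation "ph \<equiv> proj_hor M"
abbreviation "pv \<equiv> proj_vert M"
abbreviation "H \<equiv> hor_part M"
abbreviation "P \<equiv> vert_part M"

text \<open>Several notions below quantify over fields defined on an arbitrarily small neighbourhood of a
  point; restriction to such a neighbourhood reduces them to fields on \<open>V\<close>.\<close>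

lemma restrict:
  assumes "open V'" "V' \<subseteq> V"
  shows "framed_foliation M V' D m Xf Zf"
proof unfold_locales
  show "orthonormal_frame M (hor M) DIM('b) V' Xf" "orthonormal_frame M (vert M) m V' Zf"
    using frame_hor frame_vert assms unfolding orthonormal_frame_def
    by (auto intro: smooth_vf_subset)
qed (use assms metric levi_civita tot_geodesic in auto)

lemma g_add_left: "u \<in> T q \<Longrightarrow> v \<in> T q \<Longrightarrow> w \<in> T q \<Longrightarrow> g q (u + v) w = g q u w + g q v w"
  and g_scale_left: "u \<in> T q \<Longrightarrow> w \<in> T q \<Longrightarrow> g q (c \<cdot>\<^sub>t u) w = c * g q u w"
  and g_sym: "u \<in> T q \<Longrightarrow> v \<in> T q \<Longrightarrow> g q u v = g q v u"
  and g_pos: "u \<in> T q \<Longrightarrow> u \<noteq> 0 \<Longrightarrow> g q u u > 0"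
  using metric unfolding riemannian_metric_def by blast+

lemma g_smooth: "vf X \<Longrightarrow> vf Y \<Longrightarrow> sf (\<lambda>q. g q (X q) (Y q))"
  using metric openV unfolding riemannian_metric_def by blast

lemma tscale_simps: "0 \<cdot>\<^sub>t u = 0" "1 \<cdot>\<^sub>t u = u" "(-1) \<cdot>\<^sub>t u = - u" "c \<cdot>\<^sub>t 0 = 0"
  by (auto simp: tscale_def fun_eq_iff)

lemma g_zero_left: "w \<in> T q \<Longrightarrow> g q 0 w = 0"
  using g_scale_left[OF tangent_zero, of w q 0] by (simp add: tscale_simps)

lemma g_uminus_left: "u \<in> T q \<Longrightarrow> w \<in> T q \<Longrightarrow> g q (- u) w = - g q u w"
  using g_scale_left[of u q w "-1"] by (simp add: tscale_simps)

lemma g_minus_left: "u \<in> T q \<Longrightarrow> v \<in> T q \<Longrightarrow> w \<in> T q \<Longrightarrow> g q (u - v) w = g q u w - g q v w"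
  using g_add_left[of u q "- v" w] by (simp add: g_uminus_left tangent_uminus)

lemma g_add_right: "u \<in> T q \<Longrightarrow> v \<in> T q \<Longrightarrow> w \<in> T q \<Longrightarrow> g q w (u + v) = g q w u + g q w v"
  using g_add_left[of u q v w] by (simp add: g_sym[of w] tangent_add)

lemma g_scale_right: "u \<in> T q \<Longrightarrow> w \<in> T q \<Longrightarrow> g q w (c \<cdot>\<^sub>t u) = c * g q w u"
  using g_scale_left[of u q w c] by (simp add: g_sym[of w] tangent_scale)

lemma g_zero_right: "w \<in> T q \<Longrightarrow> g q w 0 = 0"
  using g_zero_left[of w q] by (simp add: g_sym[of w] tangent_zero)

lemma g_uminus_right: "u \<in> T q \<Longrightarrow> w \<in> T q \<Longrightarrow> g q w (- u) = - g q w u"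
  using g_uminus_left[of u q w] by (simp add: g_sym[of w] tangent_uminus)

lemma g_minus_right: "u \<in> T q \<Longrightarrow> v \<in> T q \<Longrightarrow> w \<in> T q \<Longrightarrow> g q w (u - v) = g q w u - g q w v"
  using g_minus_left[of u q v w] by (simp add: g_sym[of w] tangent_minus)

lemma g_lincomb_left:
  "\<forall>i\<in>I. F i \<in> T q \<Longrightarrow> w \<in> T q \<Longrightarrow> g q (\<Sum>i\<in>I. c i \<cdot>\<^sub>t F i) w = (\<Sum>i\<in>I. c i * g q (F i) w)"
  by (induction I rule: infinite_finite_induct)
    (simp_all add: g_zero_left g_add_left g_scale_left tangent_sum tangent_scale)

lemma g_lincomb_right:
  "\<forall>i\<in>I. F i \<in> T q \<Longrightarrow> w \<in> T q \<Longrightarrow> g q w (\<Sum>i\<in>I. c i \<cdot>\<^sub>t F i) = (\<Sum>i\<in>I. c i * g q w (F i))"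
  by (induction I rule: infinite_finite_induct)
    (simp_all add: g_zero_right g_add_right g_scale_right tangent_sum tangent_scale)

lemma vert_tangent: "v \<in> vert M q \<Longrightarrow> v \<in> T q"
  unfolding vert_def by simp

lemma hor_tangent: "v \<in> hor M q \<Longrightarrow> v \<in> T q"
  unfolding hor_def by simp

lemma hor_vert: "u \<in> hor M q \<Longrightarrow> v \<in> vert M q \<Longrightarrow> g q u v = 0"
  unfolding hor_def by simp

lemma vert_hor: "u \<in> hor M q \<Longrightarrow> v \<in> vert M q \<Longrightarrow> g q v u = 0"
  using hor_vert[of u q v] g_sym[of u q v] by (simp add: hor_tangent vert_tangent)

lemma vert_add: "u \<in> vert M q \<Longrightarrow> v \<in> vert M q \<Longrightarrow> u + v \<in> vert M q"
  unfolding vert_def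
  by (auto simp: tangent_add differential_def scaleR_add_left sum.distrib)

lemma vert_scale: "v \<in> vert M q \<Longrightarrow> c \<cdot>\<^sub>t v \<in> vert M q"
  unfolding vert_def
  by (auto simp: tangent_scale differential_def tscale_apply simp flip: scaleR_scaleR scaleR_sum_right)

lemma vert_zero: "0 \<in> vert M q"
  unfolding vert_def by (auto simp: tangent_zero differential_def)

lemma vert_uminus: "v \<in> vert M q \<Longrightarrow> - v \<in> vert M q"
  using vert_scale[of v q "-1"] by (simp add: tscale_simps)

lemma vert_minus: "u \<in> vert M q \<Longrightarrow> v \<in> vert M q \<Longrightarrow> u - v \<in> vert M q"
  using vert_add[of u q "- v"] vert_uminus[of v q] by simp

lemma vert_sum: "(\<And>i. i \<in> I \<Longrightarrow> F i \<in> vert M q) \<Longrightarrow> (\<Sum>i\<in>I. F i) \<in> vert M q"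
  by (induction I rule: infinite_finite_induct) (auto intro: vert_add simp: vert_zero)

lemma hor_add: "u \<in> hor M q \<Longrightarrow> v \<in> hor M q \<Longrightarrow> u + v \<in> hor M q"
  unfolding hor_def by (auto simp: tangent_add g_add_left vert_tangent)

lemma hor_scale: "v \<in> hor M q \<Longrightarrow> c \<cdot>\<^sub>t v \<in> hor M q"
  unfolding hor_def by (auto simp: tangent_scale g_scale_left vert_tangent)

lemma hor_zero: "0 \<in> hor M q"
  unfolding hor_def by (auto simp: tangent_zero g_zero_left vert_tangent)

lemma hor_sum: "(\<And>i. i \<in> I \<Longrightarrow> F i \<in> hor M q) \<Longrightarrow> (\<Sum>i\<in>I. F i) \<in> hor M q"
  by (induction I rule: infinite_finite_induct) (auto intro: hor_add simp: hor_zero)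

lemma hor_vert_zero: "u \<in> hor M q \<Longrightarrow> u \<in> vert M q \<Longrightarrow> u = 0"
  using hor_vert[of u q u] g_pos[of u q] hor_tangent[of u q] by force

lemma frame:
  shows vf_Xf: "i < DIM('b) \<Longrightarrow> vf (Xf i)" and vf_Zf: "l < m \<Longrightarrow> vf (Zf l)"
    and Xf_hor: "i < DIM('b) \<Longrightarrow> q \<in> V \<Longrightarrow> Xf i q \<in> hor M q"
    and Zf_vert: "l < m \<Longrightarrow> q \<in> V \<Longrightarrow> Zf l q \<in> vert M q"
  using frame_hor frame_vert unfolding orthonormal_frame_def by auto

lemma Xf_tangent: "i < DIM('b) \<Longrightarrow> q \<in> V \<Longrightarrow> Xf i q \<in> T q"
  and Zf_tangent: "l < m \<Longrightarrow> q \<in> V \<Longrightarrow> Zf l q \<in> T q"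
  by (rule hor_tangent[OF Xf_hor], assumption+) (rule vert_tangent[OF Zf_vert], assumption+)

lemma hor_expand:
  assumes "q \<in> V" "u \<in> hor M q"
  shows "u = (\<Sum>i<DIM('b). g q u (Xf i q) \<cdot>\<^sub>t Xf i q)"
proof -
  obtain c where c: "u = (\<Sum>i<DIM('b). c i \<cdot>\<^sub>t Xf i q)"
    using frame_hor assms unfolding orthonormal_frame_def by blast
  have "g q u (Xf j q) = c j" if "j < DIM('b)" for j
  proof -
    have "g q u (Xf j q) = (\<Sum>i<DIM('b). c i * g q (Xf i q) (Xf j q))"
      unfolding c using that assms(1)
      by (simp add: g_lincomb_left Xf_tangent tangent_scale)
    also have "\<dots> = (\<Sum>i<DIM('b). if i = j then c i else 0)"
      using frame_hor assms(1) that unfolding orthonormal_frame_def by (intro sum.cong) auto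
    finally show ?thesis using that by simp
  qed
  then show ?thesis by (subst c) (intro sum.cong, auto)
qed

lemma vert_expand:
  assumes "q \<in> V" "u \<in> vert M q"
  shows "u = (\<Sum>l<m. g q u (Zf l q) \<cdot>\<^sub>t Zf l q)"
proof -
  obtain c where c: "u = (\<Sum>i<m. c i \<cdot>\<^sub>t Zf i q)"
    using frame_vert assms unfolding orthonormal_frame_def by blast
  have "g q u (Zf j q) = c j" if "j < m" for j
  proof -
    have "g q u (Zf j q) = (\<Sum>i<m. c i * g q (Zf i q) (Zf j q))"
      unfolding c using that assms(1)
      by (simp add: g_lincomb_left Zf_tangent tangent_scale)
    also have "\<dots> = (\<Sum>i<m. if i = j then c i else 0)"
      using frame_vert assms(1) that unfolding orthonormal_frame_def by (intro sum.cong) auto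
    finally show ?thesis using that by simp
  qed
  then show ?thesis by (subst c) (intro sum.cong, auto)
qed

lemma part_eqI:
  assumes "u \<in> hor M q" "w \<in> vert M q"
  shows "H q (u + w) = u" "P q (u + w) = w"
proof -
  have "u' = u" if "u' \<in> hor M q" "u + w - u' \<in> vert M q" for u'
  proof -
    have "u + (-1) \<cdot>\<^sub>t u' \<in> hor M q" using assms(1) that(1) hor_add hor_scale by blast
    moreover have "(u + w - u') - w \<in> vert M q" using vert_minus that(2) assms(2) by blast
    ultimately show ?thesis using hor_vert_zero[of "u - u'" q] by (simp add: tscale_simps)
  qed
  then show "H q (u + w) = u" unfolding hor_part_def using assms by (intro the_equality) auto
  have "w' = w" if "w' \<in> vert M q" "u + w - w' \<in> hor M q" for w'
  proof -
    have "w - w' \<in> vert M q" using vert_minus that(1) assms(2) by blast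
    moreover have "(u + w - w') + (-1) \<cdot>\<^sub>t u \<in> hor M q" using assms(1) that(2) hor_add hor_scale by blast
    ultimately show ?thesis using hor_vert_zero[of "w - w'" q] by (simp add: tscale_simps)
  qed
  then show "P q (u + w) = w" unfolding vert_part_def using assms by (intro the_equality) auto
qed

lemma part_expand:
  assumes "q \<in> V" "v \<in> T q"
  shows "P q v = (\<Sum>l<m. g q v (Zf l q) \<cdot>\<^sub>t Zf l q)"
    and "P q v \<in> vert M q" and "H q v \<in> hor M q" and "v = H q v + P q v"
proof -
  let ?w = "\<Sum>l<m. g q v (Zf l q) \<cdot>\<^sub>t Zf l q"
  have w: "?w \<in> vert M q" using assms(1) by (auto intro!: vert_sum vert_scale Zf_vert)
  have "g q (v - ?w) u = 0" if u: "u \<in> vert M q" for u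
  proof -
    have "g q ?w u = (\<Sum>l<m. g q v (Zf l q) * g q u (Zf l q))"
      using assms(1) vert_tangent[OF u]
      by (simp add: g_lincomb_left Zf_tangent tangent_scale g_sym[of _ q u])
    also have "\<dots> = g q v (\<Sum>l<m. g q u (Zf l q) \<cdot>\<^sub>t Zf l q)"
      using assms by (simp add: g_lincomb_right Zf_tangent tangent_scale mult.commute)
    also have "\<dots> = g q v u" using vert_expand[OF assms(1) u] by simp
    finally show ?thesis
      using assms(2) vert_tangent[OF u] vert_tangent[OF w] by (simp add: g_minus_left)
  qed
  then have h: "v - ?w \<in> hor M q"
    unfolding hor_def using tangent_minus[OF assms(2) vert_tangent[OF w]] by simp
  show *: "P q v = ?w" using part_eqI(2)[OF h w] by simp
  moreover have "H q v = v - ?w" using part_eqI(1)[OF h w] by simp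
  ultimately show "P q v \<in> vert M q" "H q v \<in> hor M q" "v = H q v + P q v" using w h by auto
qed

lemmas P_vert = part_expand(2) and H_hor = part_expand(3) and parts = part_expand(4)

lemma P_tangent: "q \<in> V \<Longrightarrow> v \<in> T q \<Longrightarrow> P q v \<in> T q"
  and H_tangent: "q \<in> V \<Longrightarrow> v \<in> T q \<Longrightarrow> H q v \<in> T q"
  by (rule vert_tangent[OF P_vert], assumption+) (rule hor_tangent[OF H_hor], assumption+)

lemma part_hor: "u \<in> hor M q \<Longrightarrow> H q u = u" "u \<in> hor M q \<Longrightarrow> P q u = 0"
  using part_eqI[of u q 0] vert_zero by auto

lemma part_vert: "u \<in> vert M q \<Longrightarrow> H q u = 0" "u \<in> vert M q \<Longrightarrow> P q u = u"
  using part_eqI[of 0 q u] hor_zero by auto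

lemma part_zero: "H q 0 = 0" "P q 0 = 0"
  using part_hor[OF hor_zero] by auto

lemma part_add:
  assumes "q \<in> V" "u \<in> T q" "v \<in> T q"
  shows "H q (u + v) = H q u + H q v" "P q (u + v) = P q u + P q v"
proof -
  have "u + v = (H q u + H q v) + (P q u + P q v)"
    using parts[OF assms(1,2)] parts[OF assms(1,3)] by (simp add: algebra_simps)
  then show "H q (u + v) = H q u + H q v" "P q (u + v) = P q u + P q v"
    using part_eqI[of "H q u + H q v" q "P q u + P q v"] assms
    by (auto simp: hor_add vert_add H_hor P_vert)
qed

lemma part_scale:
  assumes "q \<in> V" "u \<in> T q"
  shows "H q (c \<cdot>\<^sub>t u) = c \<cdot>\<^sub>t H q u" "P q (c \<cdot>\<^sub>t u) = c \<cdot>\<^sub>t P q u"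
proof -
  have "c \<cdot>\<^sub>t u = c \<cdot>\<^sub>t H q u + c \<cdot>\<^sub>t P q u"
    by (subst parts[OF assms]) (simp add: tscale_def fun_eq_iff algebra_simps)
  then show "H q (c \<cdot>\<^sub>t u) = c \<cdot>\<^sub>t H q u" "P q (c \<cdot>\<^sub>t u) = c \<cdot>\<^sub>t P q u"
    using part_eqI[of "c \<cdot>\<^sub>t H q u" q "c \<cdot>\<^sub>t P q u"] assms
    by (auto simp: hor_scale vert_scale H_hor P_vert)
qed

lemma part_uminus:
  "q \<in> V \<Longrightarrow> u \<in> T q \<Longrightarrow> H q (- u) = - H q u"
  "q \<in> V \<Longrightarrow> u \<in> T q \<Longrightarrow> P q (- u) = - P q u"
  using part_scale[of q u "-1"] by (simp_all add: tscale_simps)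

lemma part_minus:
  "q \<in> V \<Longrightarrow> u \<in> T q \<Longrightarrow> v \<in> T q \<Longrightarrow> H q (u - v) = H q u - H q v"
  "q \<in> V \<Longrightarrow> u \<in> T q \<Longrightarrow> v \<in> T q \<Longrightarrow> P q (u - v) = P q u - P q v"
  using part_add[of q u "- v"] by (simp_all add: part_uminus tangent_uminus)

lemma g_parts:
  assumes "q \<in> V" "u \<in> T q"
  shows "w \<in> hor M q \<Longrightarrow> g q (H q u) w = g q u w" "w \<in> vert M q \<Longrightarrow> g q (P q u) w = g q u w"
    "w \<in> hor M q \<Longrightarrow> g q w (H q u) = g q w u" "w \<in> vert M q \<Longrightarrow> g q w (P q u) = g q w u"
proof -
  show 1: "w \<in> hor M q \<Longrightarrow> g q (H q u) w = g q u w"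
    using g_add_left[OF H_tangent[OF assms] P_tangent[OF assms] hor_tangent]
      vert_hor[OF _ P_vert[OF assms]] parts[OF assms] by auto
  show 2: "w \<in> vert M q \<Longrightarrow> g q (P q u) w = g q u w"
    using g_add_left[OF H_tangent[OF assms] P_tangent[OF assms] vert_tangent]
      hor_vert[OF H_hor[OF assms]] parts[OF assms] by auto
  show "w \<in> hor M q \<Longrightarrow> g q w (H q u) = g q w u" "w \<in> vert M q \<Longrightarrow> g q w (P q u) = g q w u"
    using 1 2 assms by (simp_all add: g_sym[of w] hor_tangent vert_tangent H_tangent P_tangent)
qed

lemma vf_pv: assumes X: "vf X" shows "vf (pv X)"
proof -
  have "vf (\<Sum>l<m. (\<lambda>q. g q (X q) (Zf l q)) \<cdot>\<^sub>f Zf l)"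
    by (intro vf_sum vf_fscale g_smooth) (auto simp: vf_Zf X)
  moreover have "(\<Sum>l<k. (\<lambda>q. g q (X q) (Zf l q)) \<cdot>\<^sub>f Zf l) q = (\<Sum>l<k. g q (X q) (Zf l q) \<cdot>\<^sub>t Zf l q)"
    for q k by (induction k) (auto simp: fscale_apply)
  ultimately show ?thesis
    by (elim vf_cong) (simp add: proj_vert_apply part_expand(1) vf_tangent X)
qed

lemma vf_ph: assumes X: "vf X" shows "vf (ph X)"
  using vf_minus[OF X vf_pv[OF X]]
proof (rule vf_cong)
  show "(X - pv X) q = ph X q" if "q \<in> V" for q
    using parts[OF that vf_tangent[OF X that]]
    by (metis add_diff_cancel_right' minus_apply proj_hor_apply proj_vert_apply)
qed

lemma ph_hor: "vf X \<Longrightarrow> q \<in> V \<Longrightarrow> ph X q \<in> hor M q"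
  and pv_vert: "vf X \<Longrightarrow> q \<in> V \<Longrightarrow> pv X q \<in> vert M q"
  and ph_pv: "vf X \<Longrightarrow> q \<in> V \<Longrightarrow> ph X q + pv X q = X q"
  using H_hor P_vert parts vf_tangent by (simp_all add: proj_hor_apply proj_vert_apply)

lemma proj_add:
  "vf X \<Longrightarrow> vf Y \<Longrightarrow> q \<in> V \<Longrightarrow> ph (X + Y) q = (ph X + ph Y) q"
  "vf X \<Longrightarrow> vf Y \<Longrightarrow> q \<in> V \<Longrightarrow> pv (X + Y) q = (pv X + pv Y) q"
  by (simp_all add: proj_hor_apply proj_vert_apply part_add vf_tangent)

lemma proj_fscale:
  "vf X \<Longrightarrow> q \<in> V \<Longrightarrow> ph (f \<cdot>\<^sub>f X) q = (f \<cdot>\<^sub>f ph X) q"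
  "vf X \<Longrightarrow> q \<in> V \<Longrightarrow> pv (f \<cdot>\<^sub>f X) q = (f \<cdot>\<^sub>f pv X) q"
  by (simp_all add: proj_hor_apply proj_vert_apply part_scale vf_tangent fscale_apply)

text \<open>A function on fields that is linear over the smooth functions and only sees the field on
  \<open>V\<close> is determined by its values on the frame; in particular it depends on the field at \<open>p\<close> only.\<close>

lemma tensor_expand:
  fixes B :: "'a vfield \<Rightarrow> real"
  assumes p: "p \<in> V" and Y: "vf Y"
    and cong: "\<And>Y Y'. vf Y \<Longrightarrow> (\<And>q. q \<in> V \<Longrightarrow> Y q = Y' q) \<Longrightarrow> B Y = B Y'"
    and add: "\<And>Y Y'. vf Y \<Longrightarrow> vf Y' \<Longrightarrow> B (Y + Y') = B Y + B Y'"
    and scale: "\<And>f Y. sf f \<Longrightarrow> vf Y \<Longrightarrow> B (f \<cdot>\<^sub>f Y) = f p * B Y"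
  shows "B Y = (\<Sum>i<DIM('b). g p (Y p) (Xf i p) * B (Xf i)) + (\<Sum>l<m. g p (Y p) (Zf l p) * B (Zf l))"
proof -
  let ?h = "\<lambda>F i. (\<lambda>q. g q (Y q) (F i q)) \<cdot>\<^sub>f F i"
  have "B 0 = 0" using add[OF vf_zero vf_zero] by simp
  then have sum: "vf (\<Sum>i<k. ?h F i) \<and> B (\<Sum>i<k. ?h F i) = (\<Sum>i<k. g p (Y p) (F i p) * B (F i))"
    if "\<And>i. i < k \<Longrightarrow> vf (F i)" for F and k :: nat
    using that
    by (induction k) (auto simp: vf_zero vf_add vf_fscale add scale g_smooth Y)
  have "Y q = ((\<Sum>i<DIM('b). ?h Xf i) + (\<Sum>l<m. ?h Zf l)) q" if q: "q \<in> V" for q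
  proof -
    have *: "(\<Sum>i<k. ?h F i) q = (\<Sum>i<k. g q (Y q) (F i q) \<cdot>\<^sub>t F i q)" for F and k :: nat
      by (induction k) (auto simp: fscale_apply)
    note t = vf_tangent[OF Y q]
    have "H q (Y q) = (\<Sum>i<DIM('b). g q (Y q) (Xf i q) \<cdot>\<^sub>t Xf i q)"
      by (subst hor_expand[OF q H_hor[OF q t]])
        (intro sum.cong, auto simp: g_parts(1)[OF q t Xf_hor[OF _ q]])
    then show ?thesis using parts[OF q t] part_expand(1)[OF q t] * by simp
  qed
  then have "B Y = B ((\<Sum>i<DIM('b). ?h Xf i) + (\<Sum>l<m. ?h Zf l))" using cong[OF Y] by blast
  then show ?thesis using sum[of "DIM('b)" Xf] sum[of m Zf] add by (simp add: vf_Xf vf_Zf)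
qed

text \<open>Two vectors with the same products with all smooth fields agree, because the fields of the
  frame can be used for testing.\<close>

lemma op_of_formI:
  assumes p: "p \<in> V" and w: "w \<in> T p"
    and B: "\<And>Y. smooth_vf_near (atlas M) p Y \<Longrightarrow> g p w (Y p) = B X Y p"
  shows "op_of_form M B X p = w"
  unfolding op_of_form_def
proof (rule the_equality)
  show "w \<in> T p \<and> (\<forall>Y. smooth_vf_near (atlas M) p Y \<longrightarrow> g p w (Y p) = B X Y p)" using w B by blast
  fix w' assume w': "w' \<in> T p \<and> (\<forall>Y. smooth_vf_near (atlas M) p Y \<longrightarrow> g p w' (Y p) = B X Y p)"
  let ?d = "w' - w"
  have d: "?d \<in> T p" using w w' tangent_minus by blast
  have eq: "g p ?d (Y p) = 0" if "vf Y" for Y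
  proof -
    have "smooth_vf_near (atlas M) p Y"
      unfolding smooth_vf_near_def using that openV p by blast
    then show ?thesis using w w' B vf_tangent[OF that p] by (simp add: g_minus_left)
  qed
  have "g p ?d (H p ?d) = (\<Sum>i<DIM('b). g p (H p ?d) (Xf i p) * g p ?d (Xf i p))"
    by (subst (1) hor_expand[OF p H_hor[OF p d]])
      (use p d in \<open>simp add: g_lincomb_right Xf_tangent tangent_scale\<close>)
  also have "\<dots> = 0" using eq vf_Xf by simp
  finally have 1: "g p ?d (H p ?d) = 0" .
  have "g p ?d (P p ?d) = (\<Sum>l<m. g p (P p ?d) (Zf l p) * g p ?d (Zf l p))"
    by (subst (1) vert_expand[OF p P_vert[OF p d]])
      (use p d in \<open>simp add: g_lincomb_right Zf_tangent tangent_scale\<close>)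
  also have "\<dots> = 0" using eq vf_Zf by simp
  finally have "g p ?d ?d = 0"
    using 1 g_add_right[OF H_tangent[OF p d] P_tangent[OF p d] d] parts[OF p d] by simp
  then have "?d = 0" using g_pos[OF d] by force
  then show "w' = w" by simp
qed

text \<open>A form that is tensorial in its second argument, in the sense of the previous expansion, is
  represented by an operator.\<close>

lemma op_of_form:
  assumes p: "p \<in> V"
    and B: "\<And>V' Y. open V' \<Longrightarrow> p \<in> V' \<Longrightarrow> V' \<subseteq> V \<Longrightarrow> smooth_vf (atlas M) V' Y \<Longrightarrow>
      B X Y p = (\<Sum>i<DIM('b). g p (Y p) (Xf i p) * B X (Xf i) p) + (\<Sum>l<m. g p (Y p) (Zf l p) * B X (Zf l) p)"
  shows "op_of_form M B X p \<in> T p"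
    and "smooth_vf_near (atlas M) p Y \<Longrightarrow> g p (op_of_form M B X p) (Y p) = B X Y p"
proof -
  let ?w = "(\<Sum>i<DIM('b). B X (Xf i) p \<cdot>\<^sub>t Xf i p) + (\<Sum>l<m. B X (Zf l) p \<cdot>\<^sub>t Zf l p)"
  have w: "?w \<in> T p" 
    using p by (auto intro!: tangent_add tangent_sum tangent_scale Xf_tangent Zf_tangent)
  have *: "g p ?w (Y p) = B X Y p" if Y: "smooth_vf_near (atlas M) p Y" for Y
  proof -
    obtain W where W: "open W" "p \<in> W" "smooth_vf (atlas M) W Y"
      using Y unfolding smooth_vf_near_def by blast
    then have t: "Y p \<in> T p" unfolding smooth_vf_def by blast
    have "B X Y p = (\<Sum>i<DIM('b). g p (Y p) (Xf i p) * B X (Xf i) p) + (\<Sum>l<m. g p (Y p) (Zf l p) * B X (Zf l) p)"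
      by (rule B[of "V \<inter> W"]) (use W p openV in \<open>auto intro: smooth_vf_subset\<close>)
    moreover have "(\<Sum>i<DIM('b). B X (Xf i) p \<cdot>\<^sub>t Xf i p) \<in> T p" "(\<Sum>l<m. B X (Zf l) p \<cdot>\<^sub>t Zf l p) \<in> T p"
      using p by (auto intro!: tangent_sum tangent_scale Xf_tangent Zf_tangent)
    ultimately show ?thesis
      using p t
      by (simp add: g_add_left g_lincomb_left Xf_tangent Zf_tangent g_sym[of "Y p"] mult.commute)
  qed
  have "op_of_form M B X p = ?w" by (rule op_of_formI[where B=B and X=X, OF p w *])
  then show "op_of_form M B X p \<in> T p"
    "smooth_vf_near (atlas M) p Y \<Longrightarrow> g p (op_of_form M B X p) (Y p) = B X Y p"
    using w * by auto
qed


section \<open>The Bott connection\<close>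

lemma LC: "connection_on (atlas M) V D"
proof -
  have *: "smooth_vf (atlas M) V (D X Y)"
    "\<forall>p\<in>V. D (X + X') Y p = D X Y p + D X' Y p \<and>
               D (f \<cdot>\<^sub>f X) Y p = f p \<cdot>\<^sub>t D X Y p \<and>
               D X (Y + Y') p = D X Y p + D X Y' p \<and>
               D X (f \<cdot>\<^sub>f Y) p = X p f \<cdot>\<^sub>t Y p + f p \<cdot>\<^sub>t D X Y p"
    if "vf X" "vf X'" "vf Y" "vf Y'" "sf f" for X X' Y Y' f
    using levi_civita that openV unfolding levi_civita_def affine_connection_def by blast+
  note z = vf_zero smooth_on_const[of "atlas M" V "0::real"]
  show ?thesis
  proof unfold_locales
    show "vf X \<Longrightarrow> vf Y \<Longrightarrow> vf (D X Y)" for X Y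
      by (rule *(1)[OF _ z(1) _ z(1) z(2)])
    show "vf X \<Longrightarrow> vf X' \<Longrightarrow> vf Y \<Longrightarrow> q \<in> V \<Longrightarrow> D (X + X') Y q = D X Y q + D X' Y q" for X X' Y q
      using *(2)[OF _ _ _ z] by simp
    show "vf X \<Longrightarrow> vf Y \<Longrightarrow> sf f \<Longrightarrow> q \<in> V \<Longrightarrow> D (f \<cdot>\<^sub>f X) Y q = f q \<cdot>\<^sub>t D X Y q" for X Y f q
      using *(2)[OF _ z(1) _ z(1)] by simp
    show "vf X \<Longrightarrow> vf Y \<Longrightarrow> vf Y' \<Longrightarrow> q \<in> V \<Longrightarrow> D X (Y + Y') q = D X Y q + D X Y' q" for X Y Y' q
      using *(2)[OF _ z(1) _ _ z(2)] by simp
    show "vf X \<Longrightarrow> vf Y \<Longrightarrow> sf f \<Longrightarrow> q \<in> V \<Longrightarrow>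
        D X (f \<cdot>\<^sub>f Y) q = X q f \<cdot>\<^sub>t Y q + f q \<cdot>\<^sub>t D X Y q" for X Y f q
      using *(2)[OF _ z(1) _ z(1)] by simp
  qed
qed

end

sublocale framed_foliation \<subseteq> LC: connection_on "atlas M" V D
  by (rule LC)

context framed_foliation begin

lemma D_torsion_free: "vf X \<Longrightarrow> vf Y \<Longrightarrow> q \<in> V \<Longrightarrow> br X Y q = D X Y q - D Y X q"
proof -
  assume a: "vf X" "vf Y" "q \<in> V"
  then have "torsion (atlas M) D X Y q = 0"
    using levi_civita openV unfolding levi_civita_def by blast
  then show ?thesis unfolding torsion_def by simp
qed

lemma D_metric:
  "vf X \<Longrightarrow> vf Y \<Longrightarrow> vf Z \<Longrightarrow> q \<in> V \<Longrightarrow>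
   X q (\<lambda>r. g r (Y r) (Z r)) = g q (D X Y q) (Z q) + g q (Y q) (D X Z q)"
  using levi_civita openV unfolding levi_civita_def by blast

lemma D_vert:
  "vf X \<Longrightarrow> vf Y \<Longrightarrow> (\<And>r. r \<in> V \<Longrightarrow> X r \<in> vert M r \<and> Y r \<in> vert M r) \<Longrightarrow> q \<in> V \<Longrightarrow>
   H q (D X Y q) = 0"
  using tot_geodesic openV unfolding totally_geodesic_leaves_def proj_hor_apply by blast

lemma br_zero: "vf X \<Longrightarrow> q \<in> V \<Longrightarrow> br X 0 q = 0" "vf X \<Longrightarrow> q \<in> V \<Longrightarrow> br 0 X q = 0"
  using br_add_right[OF _ vf_zero vf_zero, of X q] br_anti[of 0 X q] by auto

abbreviation "bc \<equiv> bott M D"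

lemma bott_apply:
  "bc X Y q = H q (D (ph X) (ph Y) q) + H q (br (pv X) (ph Y) q)
     + P q (br (ph X) (pv Y) q) + P q (D (pv X) (pv Y) q)"
  unfolding bott_def by (simp add: proj_hor_apply proj_vert_apply)

lemma bott_connection: "connection_on (atlas M) V bc"
proof unfold_locales
  note v = vf_ph vf_pv LC.vf_conn vf_br vf_add vf_fscale vf_tangent
  show "vf (bc X Y)" if "vf X" "vf Y" for X Y
    using that unfolding bott_def by (simp add: v)
  show "bc (X + X') Y q = bc X Y q + bc X' Y q" if a: "vf X" "vf X'" "vf Y" "q \<in> V" for X X' Y q
  proof -
    have "D (ph (X + X')) (ph Y) q = D (ph X + ph X') (ph Y) q"
      "D (pv (X + X')) (pv Y) q = D (pv X + pv X') (pv Y) q"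
      by (rule LC.conn_cong; simp add: v a proj_add)+
    moreover have "br (ph (X + X')) (pv Y) q = br (ph X + ph X') (pv Y) q"
      "br (pv (X + X')) (ph Y) q = br (pv X + pv X') (ph Y) q"
      by (rule br_cong; simp add: v a proj_add)+
    ultimately show ?thesis
      by (simp add: bott_apply a v LC.conn_add_left br_add_left part_add)
  qed
  show "bc X (Y + Y') q = bc X Y q + bc X Y' q" if a: "vf X" "vf Y" "vf Y'" "q \<in> V" for X Y Y' q
  proof -
    have "D (ph X) (ph (Y + Y')) q = D (ph X) (ph Y + ph Y') q"
      "D (pv X) (pv (Y + Y')) q = D (pv X) (pv Y + pv Y') q"
      by (rule LC.conn_cong; simp add: v a proj_add)+
    moreover have "br (ph X) (pv (Y + Y')) q = br (ph X) (pv Y + pv Y') q"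
      "br (pv X) (ph (Y + Y')) q = br (pv X) (ph Y + ph Y') q"
      by (rule br_cong; simp add: v a proj_add)+
    ultimately show ?thesis
      by (simp add: bott_apply a v LC.conn_add_right br_add_right part_add)
  qed
  show "bc (f \<cdot>\<^sub>f X) Y q = f q \<cdot>\<^sub>t bc X Y q" if a: "vf X" "vf Y" "sf f" "q \<in> V" for X Y f q
  proof -
    have "D (ph (f \<cdot>\<^sub>f X)) (ph Y) q = D (f \<cdot>\<^sub>f ph X) (ph Y) q"
      "D (pv (f \<cdot>\<^sub>f X)) (pv Y) q = D (f \<cdot>\<^sub>f pv X) (pv Y) q"
      by (rule LC.conn_cong; simp add: v a proj_fscale)+
    moreover have "br (ph (f \<cdot>\<^sub>f X)) (pv Y) q = br (f \<cdot>\<^sub>f ph X) (pv Y) q"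
      "br (pv (f \<cdot>\<^sub>f X)) (ph Y) q = br (f \<cdot>\<^sub>f pv X) (ph Y) q"
      by (rule br_cong; simp add: v a proj_fscale)+
    moreover have "H q (pv X q) = 0" "P q (ph X q) = 0"
      using a by (simp_all add: part_hor(2) part_vert(1) ph_hor pv_vert)
    ultimately show ?thesis
      by (simp add: bott_apply a v LC.conn_fscale_left br_fscale_left part_minus part_scale
          tangent_scale tscale_simps)
        (simp add: fun_eq_iff tscale_apply algebra_simps)
  qed
  show "bc X (f \<cdot>\<^sub>f Y) q = X q f \<cdot>\<^sub>t Y q + f q \<cdot>\<^sub>t bc X Y q"
    if a: "vf X" "vf Y" "sf f" "q \<in> V" for X Y f q
  proof -
    have "D (ph X) (ph (f \<cdot>\<^sub>f Y)) q = D (ph X) (f \<cdot>\<^sub>f ph Y) q"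
      "D (pv X) (pv (f \<cdot>\<^sub>f Y)) q = D (pv X) (f \<cdot>\<^sub>f pv Y) q"
      by (rule LC.conn_cong; simp add: v a proj_fscale)+
    moreover have "br (ph X) (pv (f \<cdot>\<^sub>f Y)) q = br (ph X) (f \<cdot>\<^sub>f pv Y) q"
      "br (pv X) (ph (f \<cdot>\<^sub>f Y)) q = br (pv X) (f \<cdot>\<^sub>f ph Y) q"
      by (rule br_cong; simp add: v a proj_fscale)+
    moreover have "H q (ph Y q) = ph Y q" "P q (pv Y q) = pv Y q"
      using a by (simp_all add: part_hor(1) part_vert(2) ph_hor pv_vert)
    ultimately have *: "bc X (f \<cdot>\<^sub>f Y) q = ph X q f \<cdot>\<^sub>t ph Y q + pv X q f \<cdot>\<^sub>t ph Y q
        + ph X q f \<cdot>\<^sub>t pv Y q + pv X q f \<cdot>\<^sub>t pv Y q + f q \<cdot>\<^sub>t bc X Y q"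
      by (simp add: bott_apply a v LC.conn_leibniz br_fscale_right part_add part_scale
          tangent_scale tangent_add)
        (simp add: fun_eq_iff tscale_apply algebra_simps)
    show ?thesis
      unfolding * ph_pv[OF a(1,4), symmetric] ph_pv[OF a(2,4), symmetric]
      by (simp add: fun_eq_iff tscale_apply algebra_simps)
  qed
qed

end

sublocale framed_foliation \<subseteq> bott: connection_on "atlas M" V "bott M D"
  by (rule bott_connection)

context framed_foliation begin

abbreviation "tor \<equiv> bott_torsion M D"

lemma proj_proj:
  "vf X \<Longrightarrow> q \<in> V \<Longrightarrow> ph (ph X) q = ph X q"
  "vf X \<Longrightarrow> q \<in> V \<Longrightarrow> pv (ph X) q = 0"
  "vf X \<Longrightarrow> q \<in> V \<Longrightarrow> ph (pv X) q = 0"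
  "vf X \<Longrightarrow> q \<in> V \<Longrightarrow> pv (pv X) q = pv X q"
  by (simp_all add: proj_hor_apply[of M "ph X"] proj_vert_apply[of M "ph X"] proj_hor_apply[of M "pv X"]
      proj_vert_apply[of M "pv X"] part_hor part_vert ph_hor pv_vert)

lemma proj_of_hor:
  "X q \<in> hor M q \<Longrightarrow> ph X q = X q" "X q \<in> hor M q \<Longrightarrow> pv X q = 0"
  by (simp_all add: proj_hor_apply proj_vert_apply part_hor)

lemma proj_of_vert:
  "X q \<in> vert M q \<Longrightarrow> pv X q = X q" "X q \<in> vert M q \<Longrightarrow> ph X q = 0"
  by (simp_all add: proj_hor_apply proj_vert_apply part_vert)

lemma bott_hor_apply:
  assumes a: "vf X" "vf Y" "q \<in> V" and h: "\<And>r. r \<in> V \<Longrightarrow> Y r \<in> hor M r"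
  shows "bc X Y q = H q (D (ph X) Y q) + H q (br (pv X) Y q)"
proof -
  note v = vf_ph vf_pv LC.vf_conn vf_br vf_zero
  have "D (ph X) (ph Y) q = D (ph X) Y q" "D (pv X) (pv Y) q = D (pv X) 0 q"
    by (rule LC.conn_cong; simp add: v a proj_of_hor h)+
  moreover have "br (pv X) (ph Y) q = br (pv X) Y q" "br (ph X) (pv Y) q = br (ph X) 0 q"
    by (rule br_cong; simp add: v a proj_of_hor h)+
  moreover have "D (pv X) 0 q = 0"
    using LC.conn_add_right[OF vf_pv[OF a(1)] vf_zero vf_zero a(3)] by simp
  ultimately show ?thesis by (simp add: bott_apply br_zero v a part_zero)
qed

lemma bott_vert_apply:
  assumes a: "vf X" "vf Y" "q \<in> V" and h: "\<And>r. r \<in> V \<Longrightarrow> Y r \<in> vert M r"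
  shows "bc X Y q = P q (br (ph X) Y q) + P q (D (pv X) Y q)"
proof -
  note v = vf_ph vf_pv LC.vf_conn vf_br vf_zero
  have "D (pv X) (pv Y) q = D (pv X) Y q" "D (ph X) (ph Y) q = D (ph X) 0 q"
    by (rule LC.conn_cong; simp add: v a proj_of_vert h)+
  moreover have "br (ph X) (pv Y) q = br (ph X) Y q" "br (pv X) (ph Y) q = br (pv X) 0 q"
    by (rule br_cong; simp add: v a proj_of_vert h)+
  moreover have "D (ph X) 0 q = 0"
    using LC.conn_add_right[OF vf_ph[OF a(1)] vf_zero vf_zero a(3)] by simp
  ultimately show ?thesis by (simp add: bott_apply br_zero v a part_zero)
qed

text \<open>The Bott connection preserves the splitting of the tangent bundle.\<close>

lemma bott_hor:
  assumes a: "vf X" "vf Y" "q \<in> V" and h: "\<And>r. r \<in> V \<Longrightarrow> Y r \<in> hor M r"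
  shows "bc X Y q \<in> hor M q"
  by (simp add: bott_hor_apply[OF a h] hor_add H_hor a vf_tangent LC.vf_conn vf_br vf_ph vf_pv)

lemma bott_vert:
  assumes a: "vf X" "vf Y" "q \<in> V" and h: "\<And>r. r \<in> V \<Longrightarrow> Y r \<in> vert M r"
  shows "bc X Y q \<in> vert M q"
  by (simp add: bott_vert_apply[OF a h] vert_add P_vert a vf_tangent LC.vf_conn vf_br vf_ph vf_pv)

lemma bott_split:
  assumes a: "vf X" "vf Y" "q \<in> V"
  shows "ph (bc X Y) q = bc X (ph Y) q"
proof -
  have "bc X Y q = bc X (ph Y + pv Y) q"
    by (rule bott.conn_cong) (simp_all add: a ph_pv)
  also have "\<dots> = bc X (ph Y) q + bc X (pv Y) q"
    by (rule bott.conn_add_right) (simp_all add: a vf_ph vf_pv)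
  finally show ?thesis
    by (simp add: proj_hor_apply[of M "bc X Y"] part_eqI bott_hor bott_vert a vf_ph vf_pv ph_hor pv_vert)
qed

text \<open>With a horizontal first argument the torsion is the curvature of the horizontal
  distribution.\<close>

lemma tor_hor:
  assumes a: "vf X" "vf Y" "q \<in> V" and h: "\<And>r. r \<in> V \<Longrightarrow> X r \<in> hor M r"
  shows "tor X Y q = - P q (br X (ph Y) q)"
proof -
  note v = vf_ph vf_pv LC.vf_conn vf_br vf_zero
  have "D (ph X) (ph Y) q = D X (ph Y) q" "D (pv X) (pv Y) q = D 0 (pv Y) q"
    by (rule LC.conn_cong; simp add: v a proj_of_hor h)+
  moreover have "br (ph X) (pv Y) q = br X (pv Y) q" "br (pv X) (ph Y) q = br 0 (ph Y) q"
    by (rule br_cong; simp add: v a proj_of_hor h)+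
  ultimately have 1: "bc X Y q = H q (D X (ph Y) q) + P q (br X (pv Y) q)"
    by (simp add: bott_apply br_zero v a part_zero LC.conn_zero_left)
  have 2: "bc Y X q = H q (D (ph Y) X q) + H q (br (pv Y) X q)"
    by (rule bott_hor_apply[OF a(2,1,3) h])
  have "br X Y q = br X (ph Y + pv Y) q"
    by (rule br_cong) (simp_all add: a ph_pv)
  also have "\<dots> = br X (ph Y) q + br X (pv Y) q"
    by (rule br_add_right) (simp_all add: a v)
  finally have 3: "br X Y q = br X (ph Y) q + br X (pv Y) q" .
  have 4: "H q (br X (ph Y) q) = H q (D X (ph Y) q) - H q (D (ph Y) X q)"
    by (simp add: D_torsion_free a v part_minus vf_tangent)
  have 5: "H q (br (pv Y) X q) = - H q (br X (pv Y) q)"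
    by (simp add: br_anti[of "pv Y" X] a v part_uminus vf_tangent)
  have "br X (ph Y) q = H q (br X (ph Y) q) + P q (br X (ph Y) q)"
    "br X (pv Y) q = H q (br X (pv Y) q) + P q (br X (pv Y) q)"
    by (rule parts; simp add: a v vf_tangent)+
  then show ?thesis
    unfolding bott.tor_apply 1 2 3 5 using 4 by (simp add: algebra_simps)
qed

lemma tor_hor_vert:
  assumes a: "vf X" "vf Y" "q \<in> V" and h: "\<And>r. r \<in> V \<Longrightarrow> X r \<in> hor M r"
  shows "tor X Y q \<in> vert M q"
  using tor_hor[OF assms] a by (simp add: vert_uminus P_vert vf_tangent vf_br vf_ph)

lemma tor_hor_ph:
  assumes a: "vf X" "vf Y" "q \<in> V" and h: "\<And>r. r \<in> V \<Longrightarrow> X r \<in> hor M r"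
  shows "tor X (ph Y) q = tor X Y q"
proof -
  have "br X (ph (ph Y)) q = br X (ph Y) q"
    by (rule br_cong) (simp_all add: a vf_ph proj_proj)
  then show ?thesis by (simp add: tor_hor[OF _ _ _ h] a vf_ph)
qed

lemma bott_hor_vert_apply:
  assumes a: "vf A" "vf Y" "q \<in> V" and A: "\<And>r. r \<in> V \<Longrightarrow> A r \<in> hor M r"
    and Y: "\<And>r. r \<in> V \<Longrightarrow> Y r \<in> vert M r"
  shows "bc A Y q = P q (br A Y q)"
proof -
  have "br (ph A) Y q = br A Y q"
    by (rule br_cong) (simp_all add: vf_ph a proj_of_hor A)
  moreover have "D (pv A) Y q = D 0 Y q"
    by (rule LC.conn_cong) (simp_all add: vf_pv a proj_of_hor A)
  ultimately show ?thesis
    using bott_vert_apply[OF a Y] by (simp add: LC.conn_zero_left a part_zero)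
qed

text \<open>In horizontal directions the Bott connection is metric. On the vertical bundle this is
  where the leaves have to be totally geodesic.\<close>

lemma bott_metric_hor:
  assumes a: "vf A" "vf Y" "vf W" "q \<in> V" and A: "\<And>r. r \<in> V \<Longrightarrow> A r \<in> hor M r"
    and h: "\<And>r. r \<in> V \<Longrightarrow> Y r \<in> hor M r" "\<And>r. r \<in> V \<Longrightarrow> W r \<in> hor M r"
  shows "A q (\<lambda>r. g r (Y r) (W r)) = g q (bc A Y q) (W q) + g q (Y q) (bc A W q)"
proof -
  have *: "bc A Y q = H q (D A Y q)" if "vf Y" "\<And>r. r \<in> V \<Longrightarrow> Y r \<in> hor M r" for Y
  proof -
    have "D (ph A) Y q = D A Y q"
      by (rule LC.conn_cong) (simp_all add: vf_ph a that proj_of_hor A)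
    moreover have "br (pv A) Y q = br 0 Y q"
      by (rule br_cong) (simp_all add: vf_pv a that proj_of_hor A)
    ultimately show ?thesis
      using bott_hor_apply[OF a(1) that(1) a(4) that(2)] by (simp add: br_zero a that part_zero)
  qed
  show ?thesis
    using D_metric[OF a] by (simp add: * a h g_parts vf_tangent LC.vf_conn)
qed

lemma bott_metric_vert:
  assumes a: "vf A" "vf Y" "vf W" "q \<in> V" and A: "\<And>r. r \<in> V \<Longrightarrow> A r \<in> hor M r"
    and h: "\<And>r. r \<in> V \<Longrightarrow> Y r \<in> vert M r" "\<And>r. r \<in> V \<Longrightarrow> W r \<in> vert M r"
  shows "A q (\<lambda>r. g r (Y r) (W r)) = g q (bc A Y q) (W q) + g q (Y q) (bc A W q)"
proof -
  \<comment> \<open>\<open>0 = Y (g(A, W)) = g(D\<^sub>Y A, W) + g(A, D\<^sub>Y W)\<close>, and \<open>D\<^sub>Y W\<close> is vertical.\<close>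
  have geod: "g q (D Y A q) (W q) = 0"
    if y: "vf Y" "\<And>r. r \<in> V \<Longrightarrow> Y r \<in> vert M r" and w: "vf W" "\<And>r. r \<in> V \<Longrightarrow> W r \<in> vert M r" for Y W
  proof -
    have "Y q (\<lambda>r. g r (A r) (W r)) = Y q (\<lambda>_. 0)"
      by (rule tvec_cong[OF vf_tangent[OF y(1) a(4)] a(4)]) (simp add: hor_vert A w)
    moreover have "g q (A q) (D Y W q) = g q (A q) (H q (D Y W q))"
      using a y w A by (simp add: g_parts vf_tangent LC.vf_conn)
    moreover have "H q (D Y W q) = 0"
      by (rule D_vert) (simp_all add: a y w)
    ultimately show ?thesis
      using D_metric[OF y(1) a(1) w(1) a(4)]
      by (simp add: tvec_zero[OF vf_tangent[OF y(1) a(4)]] g_zero_right vf_tangent a)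
  qed
  have "g q (bc A Y q) (W q) = g q (br A Y q) (W q)" "g q (Y q) (bc A W q) = g q (Y q) (br A W q)"
    by (simp_all add: bott_hor_vert_apply[OF _ _ _ A] a h g_parts vf_tangent vf_br)
  moreover have "g q (br A Y q) (W q) = g q (D A Y q) (W q)" "g q (Y q) (br A W q) = g q (Y q) (D A W q)"
    using geod[OF a(2) h(1) a(3) h(2)] geod[OF a(3) h(2) a(2) h(1)]
    by (simp_all add: a vf_tangent D_torsion_free LC.vf_conn g_minus_left g_minus_right g_sym[of "Y q"])
  ultimately show ?thesis using D_metric[OF a] by simp
qed


section \<open>The endomorphisms \<open>J\<^sub>Z\<close>\<close>

abbreviation "J \<equiv> J_op M D"

text \<open>The vertical part of the frame does not contribute to the expansion, since \<open>T(A, Z) = 0\<close> for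
  horizontal \<open>A\<close> and vertical \<open>Z\<close>.\<close>

lemma tor_expand:
  assumes p: "p \<in> V" and A: "vf A" "\<And>r. r \<in> V \<Longrightarrow> A r \<in> hor M r" and Y: "vf Y" and u: "u \<in> T p"
  shows "g p u (tor A Y p) = (\<Sum>i<DIM('b). g p (Y p) (Xf i p) * g p u (tor A (Xf i) p))"
proof -
  note t = vf_tangent bott.vf_tor
  have "g p u (tor A Y p) = (\<Sum>i<DIM('b). g p (Y p) (Xf i p) * g p u (tor A (Xf i) p))
      + (\<Sum>l<m. g p (Y p) (Zf l p) * g p u (tor A (Zf l) p))"
  proof (rule tensor_expand[OF p Y])
    show "g p u (tor A Y p) = g p u (tor A Y' p)" if "vf Y" "\<And>q. q \<in> V \<Longrightarrow> Y q = Y' q" for Y Y'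
      using bott.tor_cong[OF A(1) that(1) p, of A Y'] that(2) by simp
    show "g p u (tor A (Y + Y') p) = g p u (tor A Y p) + g p u (tor A Y' p)" if "vf Y" "vf Y'" for Y Y'
      unfolding bott.tor_add_right[OF A(1) that p]
      by (rule g_add_right) (simp_all add: t A that u p)
    show "g p u (tor A (f \<cdot>\<^sub>f Y) p) = f p * g p u (tor A Y p)" if "sf f" "vf Y" for f Y
      unfolding bott.tor_fscale_right[OF A(1) that(2,1) p]
      by (rule g_scale_right) (simp_all add: t A that u p)
  qed
  moreover have "g p u (tor A (Zf l) p) = 0" if l: "l < m" for l
  proof -
    have "br A (ph (Zf l)) p = br A 0 p"
      by (rule br_cong) (simp_all add: A p vf_ph vf_Zf l proj_of_vert Zf_vert)
    then show ?thesis
      by (simp add: tor_hor[OF A(1) vf_Zf[OF l] p A(2)] br_zero A p part_zero g_zero_right u)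
  qed
  ultimately show ?thesis by simp
qed

text \<open>The description of \<open>J\<^sub>Z X\<close> by its products with all local horizontal fields has the following
  unique solution, which shows in particular that \<open>J\<^sub>Z X\<close> is smooth.\<close>

lemma J_frame:
  assumes p: "p \<in> V" and Z: "vf Z" and X: "vf X"
  shows "J Z X p = (\<Sum>i<DIM('b). g p (pv Z p) (tor (ph X) (Xf i) p) \<cdot>\<^sub>t Xf i p)" (is "_ = ?w")
  unfolding J_op_def
proof (rule the_equality, safe)
  show "?w \<in> hor M p" by (auto intro!: hor_sum hor_scale Xf_hor p)
next
  fix U Y
  assume U: "open U" "p \<in> U" and Y: "smooth_vf (atlas M) U Y" "\<forall>q\<in>U. Y q \<in> hor M q"
  interpret S: framed_foliation M "V \<inter> U" D m Xf Zf
    by (rule restrict) (use U openV in auto)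
  have v: "S.vf Y" "S.vf Z" "S.vf (ph X)"
    using Y(1) Z vf_ph[OF X] by (auto intro: smooth_vf_subset)
  have "g p (pv Z p) (tor (ph X) Y p)
      = (\<Sum>i<DIM('b). g p (Y p) (Xf i p) * g p (pv Z p) (tor (ph X) (Xf i) p))"
    by (rule S.tor_expand)
      (use p U v in \<open>auto intro: ph_hor[OF X] vert_tangent[OF pv_vert[OF Z]]\<close>)
  also have "\<dots> = g p ?w (Y p)"
    using S.vf_tangent[OF v(1)] p U
    by (simp add: g_lincomb_left Xf_tangent g_sym[of "Y p"] mult.commute)
  finally show "g p ?w (Y p) = g p (pv Z p) (tor (ph X) Y p)" by simp
next
  fix w
  assume w: "w \<in> hor M p" "\<forall>U Y. open U \<and> p \<in> U \<and> smooth_vf (atlas M) U Y \<and> (\<forall>q\<in>U. Y q \<in> hor M q) \<longrightarrow>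
      g p w (Y p) = g p (pv Z p) (tor (ph X) Y p)"
  have "g p w (Xf i p) = g p (pv Z p) (tor (ph X) (Xf i) p)" if "i < DIM('b)" for i
    using w(2) openV p vf_Xf[OF that] Xf_hor[OF that] by blast
  then show "w = ?w"
    by (subst hor_expand[OF p w(1)]) (intro sum.cong, auto)
qed

lemma J_hor: "vf Z \<Longrightarrow> vf X \<Longrightarrow> q \<in> V \<Longrightarrow> J Z X q \<in> hor M q"
  by (auto simp: J_frame intro!: hor_sum hor_scale Xf_hor)

lemma J_metric:
  assumes "q \<in> V" "vf Z" "vf X" "vf Y"
  shows "g q (J Z X q) (Y q) = g q (pv Z q) (tor (ph X) Y q)"
  using tor_expand[OF assms(1) vf_ph[OF assms(3)] ph_hor[OF assms(3)] assms(4), of "pv Z q"]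
  by (simp add: J_frame assms g_lincomb_left Xf_tangent vf_tangent vf_pv g_sym[of "Y q"] mult.commute)

lemma vf_J:
  assumes Z: "vf Z" and X: "vf X"
  shows "vf (J Z X)"
proof -
  have "vf (\<Sum>i<DIM('b). (\<lambda>q. g q (pv Z q) (tor (ph X) (Xf i) q)) \<cdot>\<^sub>f Xf i)"
    by (intro vf_sum vf_fscale g_smooth) (auto simp: vf_Xf vf_pv vf_ph Z X bott.vf_tor)
  moreover have "(\<Sum>i<k. h i \<cdot>\<^sub>f Xf i) q = (\<Sum>i<k. h i q \<cdot>\<^sub>t Xf i q)" for h q and k :: nat
    by (induction k) (auto simp: fscale_apply)
  ultimately show ?thesis
    by (elim vf_cong) (simp add: J_frame Z X)
qed

lemma J_cong:
  assumes "q \<in> V" "vf Z" "vf X" "\<And>r. r \<in> V \<Longrightarrow> X r = X' r"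
  shows "J Z X q = J Z X' q"
proof -
  have X': "vf X'" using vf_cong[OF assms(3), of X'] assms(4) by auto
  have "tor (ph X) (Xf i) q = tor (ph X') (Xf i) q" if "i < DIM('b)" for i
    by (rule bott.tor_cong) (simp_all add: assms vf_ph vf_Xf that proj_hor_apply)
  then show ?thesis by (simp add: J_frame assms(1-3) X')
qed

lemma J_hor_zero:
  assumes "q \<in> V" "vf A" "A q \<in> hor M q" "vf X"
  shows "J A X q = 0"
proof -
  have "g q (pv A q) (tor (ph X) (Xf i) q) = 0" if "i < DIM('b)" for i
    using assms that by (simp add: proj_of_hor g_zero_left vf_tangent bott.vf_tor vf_ph vf_Xf)
  then show ?thesis by (simp add: J_frame assms tscale_simps)
qed

lemma vert_parseval:
  assumes "q \<in> V" "u \<in> vert M q" "w \<in> T q"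
  shows "(\<Sum>l<m. g q (Zf l q) u * g q (Zf l q) w) = g q u w"
proof -
  have "g q u w = g q (\<Sum>l<m. g q u (Zf l q) \<cdot>\<^sub>t Zf l q) w"
    using vert_expand[OF assms(1,2)] by simp
  also have "\<dots> = (\<Sum>l<m. g q u (Zf l q) * g q (Zf l q) w)"
    using assms by (simp add: g_lincomb_left Zf_tangent)
  finally show ?thesis
    using assms by (simp add: g_sym[of u] vert_tangent Zf_tangent)
qed

text \<open>The trace of \<open>J\<^sup>2\<close> over the vertical frame, traded for a trace over the horizontal frame: each
  \<open>J\<^sub>Z\<close> is skew-symmetric, so \<open>g(J\<^sub>Z J\<^sub>Z X, Y) = - g(J\<^sub>Z X, J\<^sub>Z Y)\<close>; both factors are expanded in the
  frame \<open>Xf\<close>, and Parseval's identity is applied to the sum over \<open>Zf\<close>.\<close>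

lemma J_squared_metric:
  assumes q: "q \<in> V" and X: "vf X" and Y: "vf Y"
  shows "J_squared M D m Zf X q \<in> T q" (is ?tangent)
    and "g q (J_squared M D m Zf X q) (Y q)
      = (\<Sum>i<DIM('b). g q (tor (Xf i) X q) (tor (ph Y) (Xf i) q))" (is ?metric)
proof -
  note v = vf_J vf_Zf vf_Xf vf_ph vf_pv X Y q
  have sum: "J_squared M D m Zf X q = (\<Sum>l<m. 1 \<cdot>\<^sub>t J (Zf l) (J (Zf l) X) q)"
  proof -
    have "(\<Sum>l<k. F l) q = (\<Sum>l<k. 1 \<cdot>\<^sub>t F l q)" for F :: "nat \<Rightarrow> 'a vfield" and k
      by (induction k) (auto simp: tscale_simps)
    then show ?thesis unfolding J_squared_def .
  qed
  show ?tangent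
    unfolding sum by (auto intro!: tangent_sum tangent_scale vf_tangent simp: v)
  have *: "g q (J (Zf l) (J (Zf l) X) q) (Y q)
      = - (\<Sum>i<DIM('b). g q (Zf l q) (tor (ph X) (Xf i) q) * g q (Zf l q) (tor (ph Y) (Xf i) q))"
    if l: "l < m" for l
  proof -
    let ?J = "J (Zf l) X"
    have J: "vf ?J" "\<And>r. r \<in> V \<Longrightarrow> ?J r \<in> hor M r"
      by (simp_all add: v l J_hor)
    have pvZ: "pv (Zf l) q = Zf l q" by (simp add: proj_of_vert Zf_vert l q)
    have "tor (ph ?J) Y q = tor ?J Y q"
      by (rule bott.tor_cong) (simp_all add: v J proj_of_hor)
    also have "\<dots> = - tor (ph Y) ?J q"
      using tor_hor_ph[OF J(1) Y q J(2)] bott.tor_anti[of ?J "ph Y" q] by simp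
    finally have "g q (J (Zf l) ?J q) (Y q) = - g q (Zf l q) (tor (ph Y) ?J q)"
      using J_metric[OF q vf_Zf[OF l] J(1) Y]
      by (simp add: pvZ g_uminus_right vf_tangent bott.vf_tor v J l)
    also have "g q (Zf l q) (tor (ph Y) ?J q)
        = (\<Sum>i<DIM('b). g q (?J q) (Xf i q) * g q (Zf l q) (tor (ph Y) (Xf i) q))"
      by (rule tor_expand) (simp_all add: v J ph_hor Zf_tangent l)
    also have "\<dots> = (\<Sum>i<DIM('b). g q (Zf l q) (tor (ph X) (Xf i) q) * g q (Zf l q) (tor (ph Y) (Xf i) q))"
      by (intro sum.cong) (simp_all add: J_metric v l pvZ)
    finally show ?thesis .
  qed
  have "g q (J_squared M D m Zf X q) (Y q)
      = (\<Sum>l<m. - (\<Sum>i<DIM('b). g q (Zf l q) (tor (ph X) (Xf i) q) * g q (Zf l q) (tor (ph Y) (Xf i) q)))"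
    unfolding sum by (simp add: g_lincomb_left vf_tangent v *)
  also have "\<dots> = - (\<Sum>i<DIM('b). \<Sum>l<m. g q (Zf l q) (tor (ph X) (Xf i) q) * g q (Zf l q) (tor (ph Y) (Xf i) q))"
    unfolding sum_negf by (subst sum.swap) simp
  also have "\<dots> = (\<Sum>i<DIM('b). - g q (tor (ph X) (Xf i) q) (tor (ph Y) (Xf i) q))"
    by (simp add: vert_parseval q tor_hor_vert v ph_hor vf_tangent bott.vf_tor sum_negf)
  also have "\<dots> = (\<Sum>i<DIM('b). g q (tor (Xf i) X q) (tor (ph Y) (Xf i) q))"
  proof (intro sum.cong refl)
    fix i assume "i \<in> {..<DIM('b)}"
    then have i: "i < DIM('b)" by simp
    have "tor (ph X) (Xf i) q = - tor (Xf i) X q"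
      using tor_hor_ph[OF vf_Xf[OF i] X q Xf_hor[OF i]] bott.tor_anti[of "ph X" "Xf i" q] by simp
    then show "- g q (tor (ph X) (Xf i) q) (tor (ph Y) (Xf i) q) = g q (tor (Xf i) X q) (tor (ph Y) (Xf i) q)"
      by (simp add: g_uminus_left vf_tangent bott.vf_tor v i)
  qed
  finally show ?metric .
qed


section \<open>The curvature of the adjoint connection\<close>

text \<open>As \<open>J\<^sub>A = 0\<close> for horizontal \<open>A\<close>, there is no term of order \<open>1 / \<epsilon>\<^sup>2\<close>.\<close>

lemma curvature_adjoint:
  assumes a: "vf A" "vf B" "vf Y" "q \<in> V" and A: "\<And>r. r \<in> V \<Longrightarrow> A r \<in> hor M r"
  shows "curvature (atlas M) (adjoint_conn M D \<epsilon>) A B Y q = curvature (atlas M) bc A B Y q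
    + (1 / \<epsilon>) \<cdot>\<^sub>t (bc A (J B Y) q - J B (bc A Y) q - J (br A B) Y q)"
proof -
  let ?ad = "adjoint_conn M D \<epsilon>"
  note v = vf_J bott.vf_conn vf_br vf_add a vf_fscale smooth_on_const
  have ad: "?ad X Y = bc X Y + (\<lambda>_. 1 / \<epsilon>) \<cdot>\<^sub>f J X Y" for X Y
    unfolding adjoint_conn_def ..
  have adA: "?ad A W r = bc A W r" if "vf W" "r \<in> V" for W r
    using that by (simp add: ad fscale_apply J_hor_zero a A tscale_simps)
  have "?ad A (?ad B Y) q = bc A (?ad B Y) q"
    by (rule adA) (simp_all add: ad v)
  also have "\<dots> = bc A (bc B Y) q + (1 / \<epsilon>) \<cdot>\<^sub>t bc A (J B Y) q"
    by (simp add: ad v bott.conn_add_right bott.conn_leibniz tvec_const[OF vf_tangent[OF a(1,4)]]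
        tscale_simps)
  finally have 1: "?ad A (?ad B Y) q = bc A (bc B Y) q + (1 / \<epsilon>) \<cdot>\<^sub>t bc A (J B Y) q" .
  have vad: "vf (?ad A Y)" by (simp add: ad v)
  have "bc B (?ad A Y) q = bc B (bc A Y) q"
    by (rule bott.conn_cong) (simp_all add: v vad adA)
  moreover have "J B (?ad A Y) q = J B (bc A Y) q"
    by (rule J_cong) (simp_all add: v vad adA)
  ultimately have 2: "?ad B (?ad A Y) q = bc B (bc A Y) q + (1 / \<epsilon>) \<cdot>\<^sub>t J B (bc A Y) q"
    unfolding ad[of B] by (simp add: fscale_apply)
  have 3: "?ad (br A B) Y q = bc (br A B) Y q + (1 / \<epsilon>) \<cdot>\<^sub>t J (br A B) Y q"
    by (simp add: ad fscale_apply)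
  show ?thesis
    unfolding curvature_def minus_apply 1 2 3
    by (simp add: fun_eq_iff tscale_apply algebra_simps)
qed

text \<open>Differentiating \<open>g(J\<^sub>B Y, W) = g(B, T(Y, W))\<close> in the horizontal direction \<open>A\<close> turns the
  correction term of the curvature into derivatives of the torsion.\<close>

lemma adjoint_correction:
  assumes a: "vf A" "vf B" "vf Y" "vf W" "q \<in> V" and A: "\<And>r. r \<in> V \<Longrightarrow> A r \<in> hor M r"
    and W: "\<And>r. r \<in> V \<Longrightarrow> W r \<in> hor M r"
  shows "g q (bc A (J B Y) q - J B (bc A Y) q - J (br A B) Y q) (W q)
    = - g q (B q) (nabla_torsion M D A W Y q) + g q (tor A B q) (tor (ph Y) W q)"
    (is "?lhs = _")
proof -
  note v = vf_J bott.vf_conn bott.vf_tor vf_br vf_add vf_ph vf_pv a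
  note t = v vf_tangent
  let ?b = "pv B" and ?Y = "ph Y"
  let ?t = "tor ?Y W"
  have tv: "?t r \<in> vert M r" if "r \<in> V" for r
    using that by (simp add: tor_hor_vert v ph_hor)
  \<comment> \<open>Facts 1 and 2 compute the derivative of \<open>g(J\<^sub>B Y, W)\<close> along \<open>A\<close>, in the vertical and in the
    horizontal bundle.\<close>
  have "A q (\<lambda>r. g r (J B Y r) (W r)) = A q (\<lambda>r. g r (?b r) (?t r))"
    by (rule tvec_cong[OF vf_tangent[OF a(1,5)] a(5)]) (simp add: J_metric v)
  also have "\<dots> = g q (bc A ?b q) (?t q) + g q (?b q) (bc A ?t q)"
    by (rule bott_metric_vert) (simp_all add: v A tv pv_vert)
  finally have 1: "A q (\<lambda>r. g r (J B Y r) (W r)) = g q (bc A ?b q) (?t q) + g q (?b q) (bc A ?t q)" .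
  have 2: "A q (\<lambda>r. g r (J B Y r) (W r)) = g q (bc A (J B Y) q) (W q) + g q (?b q) (tor ?Y (bc A W) q)"
    using bott_metric_hor[of A "J B Y" W q] by (simp add: v A W J_hor J_metric)
  have "tor (ph (bc A Y)) W q = tor (bc A ?Y) W q"
    by (rule bott.tor_cong) (simp_all add: v bott_split)
  then have 3: "g q (J B (bc A Y) q) (W q) = g q (?b q) (tor (bc A ?Y) W q)"
    by (simp add: J_metric v)
  have "br A B q = br A (ph B + pv B) q"
    by (rule br_cong) (simp_all add: v ph_pv)
  also have "\<dots> = br A (ph B) q + br A (pv B) q"
    by (simp add: br_add_right v)
  finally have "pv (br A B) q = P q (br A (ph B) q) + P q (br A (pv B) q)"
    by (simp add: proj_vert_apply[of M "br A B"] part_add t)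
  also have "\<dots> = - tor A B q + bc A ?b q"
    by (simp add: tor_hor[OF _ _ _ A] bott_hor_vert_apply[OF _ _ _ A] v pv_vert)
  finally have 4: "g q (J (br A B) Y q) (W q) = - g q (tor A B q) (?t q) + g q (bc A ?b q) (?t q)"
    by (simp add: J_metric t g_add_left g_uminus_left tangent_uminus g_minus_left)
  have 5: "?lhs = g q (?b q) (bc A ?t q - tor (bc A ?Y) W q - tor ?Y (bc A W) q) + g q (tor A B q) (?t q)"
    using 1 2 3 4 by (simp add: g_minus_left g_minus_right t tangent_minus)
  have 6: "bc A ?t q - tor (bc A ?Y) W q - tor ?Y (bc A W) q = - nabla_torsion M D A W Y q"
  proof -
    have "?t = - tor W ?Y" by (rule ext) (simp add: bott.tor_anti[of ?Y W])
    then have "bc A ?t q = - bc A (tor W ?Y) q"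
      by (simp add: bott.conn_uminus_right v)
    moreover have "bc A (tor W ?Y) q = bc A (tor W Y) q"
      by (rule bott.conn_cong) (simp_all add: v tor_hor_ph W)
    moreover have "tor (bc A ?Y) W q = - tor W (bc A Y) q"
    proof -
      have "tor W (bc A ?Y) q = tor W (ph (bc A Y)) q"
        by (rule bott.tor_cong) (simp_all add: v bott_split)
      also have "\<dots> = tor W (bc A Y) q" by (rule tor_hor_ph) (simp_all add: v W)
      finally show ?thesis using bott.tor_anti[of "bc A ?Y" W q] by simp
    qed
    moreover have "tor ?Y (bc A W) q = - tor (bc A W) Y q"
    proof -
      have "tor (bc A W) ?Y q = tor (bc A W) Y q"
        by (rule tor_hor_ph) (simp_all add: v bott_hor W)
      then show ?thesis using bott.tor_anti[of ?Y "bc A W" q] by simp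
    qed
    ultimately show ?thesis unfolding nabla_torsion_def by simp
  qed
  have 7: "g q (?b q) (- nabla_torsion M D A W Y q) = - g q (B q) (nabla_torsion M D A W Y q)"
  proof -
    have nt: "nabla_torsion M D A W Y q = bc A (tor W Y) q - tor (bc A W) Y q - tor W (bc A Y) q"
      unfolding nabla_torsion_def by simp
    have "nabla_torsion M D A W Y q \<in> vert M q"
      unfolding nt
      by (rule vert_minus[OF vert_minus[OF bott_vert tor_hor_vert] tor_hor_vert])
        (simp_all add: v W bott_hor tor_hor_vert)
    then have n: "- nabla_torsion M D A W Y q \<in> vert M q" "nabla_torsion M D A W Y q \<in> T q"
      by (auto intro: vert_uminus vert_tangent)
    have "g q (?b q) (- nabla_torsion M D A W Y q) = g q (B q) (- nabla_torsion M D A W Y q)"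
      unfolding proj_vert_apply by (rule g_parts(2)[OF a(5) vf_tangent[OF a(2,5)] n(1)])
    then show ?thesis using g_uminus_right[OF n(2) vf_tangent[OF a(2,5)]] by simp
  qed
  show ?thesis unfolding 5 6 7 ..
qed

section \<open>The horizontal Ricci curvature of the adjoint connection\<close>

text \<open>The factors \<open>1\<close> turn the sum into a linear combination, the form in which the metric is
  distributed over sums.\<close>

lemma delta_torsion_apply: "delta_torsion M D Xf Y q = (\<Sum>j<DIM('b). 1 \<cdot>\<^sub>t nabla_torsion M D (Xf j) (Xf j) Y q)"
proof -
  have "(\<Sum>l<k. F l) q = (\<Sum>l<k. 1 \<cdot>\<^sub>t F l q)" for F :: "nat \<Rightarrow> 'a vfield" and k :: nat
    by (induction k) (auto simp: tscale_simps)
  then show ?thesis unfolding delta_torsion_def .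
qed

lemma vf_nabla_torsion: "vf A \<Longrightarrow> vf B \<Longrightarrow> vf Y \<Longrightarrow> vf (nabla_torsion M D A B Y)"
  unfolding nabla_torsion_def by (intro vf_minus bott.vf_conn bott.vf_tor)

text \<open>The traces of \<open>curvature_adjoint\<close> and \<open>adjoint_correction\<close> over the horizontal frame.\<close>

lemma ric_adjoint:
  assumes q: "q \<in> V" and X: "vf X" and Y: "vf Y"
  shows "ric_hor M (adjoint_conn M D \<epsilon>) Xf X Y q = ric_hor M bc Xf X Y q
    - (1 / \<epsilon>) * g q (X q) (delta_torsion M D Xf Y q)
    + (1 / \<epsilon>) * g q (J_squared M D m Zf X q) (Y q)"
proof -
  note t = vf_J bott.vf_conn bott.vf_tor bott.vf_curv vf_br X Y q vf_Xf vf_tangent vf_nabla_torsion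
  let ?c = "1 / \<epsilon>"
  have "g q (ph (curvature (atlas M) (adjoint_conn M D \<epsilon>) (Xf i) X Y) q) (Xf i q)
      = g q (ph (curvature (atlas M) bc (Xf i) X Y) q) (Xf i q)
        - ?c * g q (X q) (nabla_torsion M D (Xf i) (Xf i) Y q)
        + ?c * g q (tor (Xf i) X q) (tor (ph Y) (Xf i) q)" if i: "i < DIM('b)" for i
  proof -
    let ?k = "bc (Xf i) (J X Y) q - J X (bc (Xf i) Y) q - J (br (Xf i) X) Y q"
    have k: "?k \<in> T q" by (simp add: t i tangent_minus)
    have *: "curvature (atlas M) (adjoint_conn M D \<epsilon>) (Xf i) X Y q
        = curvature (atlas M) bc (Xf i) X Y q + ?c \<cdot>\<^sub>t ?k"
      by (rule curvature_adjoint) (simp_all add: t i Xf_hor)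
    have "g q (ph (curvature (atlas M) (adjoint_conn M D \<epsilon>) (Xf i) X Y) q) (Xf i q)
        = g q (curvature (atlas M) bc (Xf i) X Y q + ?c \<cdot>\<^sub>t ?k) (Xf i q)"
      unfolding proj_hor_apply *
      by (rule g_parts(1)) (simp_all add: t i k tangent_add tangent_scale Xf_hor)
    then have 1: "g q (ph (curvature (atlas M) (adjoint_conn M D \<epsilon>) (Xf i) X Y) q) (Xf i q)
        = g q (curvature (atlas M) bc (Xf i) X Y q) (Xf i q) + ?c * g q ?k (Xf i q)"
      by (simp add: g_add_left g_scale_left t i k tangent_scale)
    have 2: "g q (curvature (atlas M) bc (Xf i) X Y q) (Xf i q)
        = g q (ph (curvature (atlas M) bc (Xf i) X Y) q) (Xf i q)"
      unfolding proj_hor_apply by (rule g_parts(1)[symmetric]) (simp_all add: t i Xf_hor)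
    have 3: "g q ?k (Xf i q) = - g q (X q) (nabla_torsion M D (Xf i) (Xf i) Y q)
        + g q (tor (Xf i) X q) (tor (ph Y) (Xf i) q)"
      by (rule adjoint_correction) (simp_all add: t i Xf_hor)
    show ?thesis unfolding 1 2 3 by (simp add: algebra_simps)
  qed
  moreover have "g q (X q) (delta_torsion M D Xf Y q)
      = (\<Sum>i<DIM('b). g q (X q) (nabla_torsion M D (Xf i) (Xf i) Y q))"
    unfolding delta_torsion_apply by (simp add: g_lincomb_right t)
  ultimately show ?thesis
    unfolding ric_hor_def
    by (simp add: J_squared_metric(2) q X Y sum.distrib sum_subtractf sum_distrib_left)
qed

text \<open>The horizontal Ricci form of the Bott connection and the form \<open>g(X, \<delta>T(Y))\<close> are tensorial in
  \<open>Y\<close>, hence are represented by operators.\<close>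

lemma ric_bott_tensor:
  assumes q: "q \<in> V" and X: "vf X" and Y: "vf Y"
  shows "ric_hor M bc Xf X Y q = (\<Sum>i<DIM('b). g q (Y q) (Xf i q) * ric_hor M bc Xf X (Xf i) q)
    + (\<Sum>l<m. g q (Y q) (Zf l q) * ric_hor M bc Xf X (Zf l) q)"
proof (rule tensor_expand[OF q Y])
  note t = q X bott.vf_curv vf_Xf vf_tangent H_tangent Xf_tangent
  show "ric_hor M bc Xf X Y q = ric_hor M bc Xf X Y' q" if "vf Y" "\<And>q. q \<in> V \<Longrightarrow> Y q = Y' q" for Y Y'
  proof -
    have "curvature (atlas M) bc (Xf i) X Y q = curvature (atlas M) bc (Xf i) X Y' q" if "i < DIM('b)" for i
      by (rule bott.curv_cong) (simp_all add: t that \<open>vf Y\<close> \<open>\<And>q. q \<in> V \<Longrightarrow> Y q = Y' q\<close>)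
    then show ?thesis unfolding ric_hor_def proj_hor_apply by simp
  qed
  show "ric_hor M bc Xf X (Y + Y') q = ric_hor M bc Xf X Y q + ric_hor M bc Xf X Y' q"
    if "vf Y" "vf Y'" for Y Y'
    unfolding ric_hor_def proj_hor_apply
    by (simp add: that t bott.curv_add part_add g_add_left sum.distrib)
  show "ric_hor M bc Xf X (f \<cdot>\<^sub>f Y) q = f q * ric_hor M bc Xf X Y q"
    if "sf f" "vf Y" for f Y
    unfolding ric_hor_def proj_hor_apply
    by (simp add: that t bott.curv_fscale part_scale g_scale_left sum_distrib_left)
qed

lemma delta_torsion_tensor:
  assumes q: "q \<in> V" and u: "u \<in> T q" and Y: "vf Y"
  shows "g q u (delta_torsion M D Xf Y q)
    = (\<Sum>i<DIM('b). g q (Y q) (Xf i q) * g q u (delta_torsion M D Xf (Xf i) q))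
    + (\<Sum>l<m. g q (Y q) (Zf l q) * g q u (delta_torsion M D Xf (Zf l) q))"
proof (rule tensor_expand[OF q Y])
  note t = q u vf_Xf vf_tangent vf_nabla_torsion
  have d: "g q u (delta_torsion M D Xf Y q) = (\<Sum>i<DIM('b). g q u (nabla_torsion M D (Xf i) (Xf i) Y q))"
    if "vf Y" for Y
    unfolding delta_torsion_apply by (simp add: g_lincomb_right t that)
  show "g q u (delta_torsion M D Xf Y q) = g q u (delta_torsion M D Xf Y' q)"
    if "vf Y" "\<And>q. q \<in> V \<Longrightarrow> Y q = Y' q" for Y Y'
  proof -
    have "nabla_torsion M D (Xf i) (Xf i) Y q = nabla_torsion M D (Xf i) (Xf i) Y' q" if "i < DIM('b)" for i
      unfolding nabla_torsion_def
      by (rule bott.dtor_cong) (simp_all add: t that \<open>vf Y\<close> \<open>\<And>q. q \<in> V \<Longrightarrow> Y q = Y' q\<close>)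
    then show ?thesis unfolding delta_torsion_apply by simp
  qed
  show "g q u (delta_torsion M D Xf (Y + Y') q)
      = g q u (delta_torsion M D Xf Y q) + g q u (delta_torsion M D Xf Y' q)"
    if "vf Y" "vf Y'" for Y Y'
  proof -
    have "nabla_torsion M D (Xf i) (Xf i) (Y + Y') q
        = nabla_torsion M D (Xf i) (Xf i) Y q + nabla_torsion M D (Xf i) (Xf i) Y' q" if "i < DIM('b)" for i
      unfolding nabla_torsion_def
      by (rule bott.dtor_add) (simp_all add: t that \<open>vf Y\<close> \<open>vf Y'\<close>)
    then show ?thesis by (simp add: d that vf_add g_add_right t sum.distrib)
  qed
  show "g q u (delta_torsion M D Xf (f \<cdot>\<^sub>f Y) q) = f q * g q u (delta_torsion M D Xf Y q)"
    if "sf f" "vf Y" for f Y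
  proof -
    have "nabla_torsion M D (Xf i) (Xf i) (f \<cdot>\<^sub>f Y) q
        = f q \<cdot>\<^sub>t nabla_torsion M D (Xf i) (Xf i) Y q" if "i < DIM('b)" for i
      unfolding nabla_torsion_def
      by (rule bott.dtor_fscale) (simp_all add: t that \<open>vf Y\<close> \<open>sf f\<close>)
    then show ?thesis by (simp add: d that vf_fscale g_scale_right t sum_distrib_left)
  qed
qed

lemma Ric_bott:
  assumes p: "p \<in> V" and X: "vf X"
  shows "Ric_op M bc Xf X p \<in> T p"
    and "smooth_vf_near (atlas M) p Y \<Longrightarrow> g p (Ric_op M bc Xf X p) (Y p) = ric_hor M bc Xf X Y p"
proof -
  have *: "ric_hor M bc Xf X Y p = (\<Sum>i<DIM('b). g p (Y p) (Xf i p) * ric_hor M bc Xf X (Xf i) p)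
    + (\<Sum>l<m. g p (Y p) (Zf l p) * ric_hor M bc Xf X (Zf l) p)"
    if V': "open V'" "p \<in> V'" "V' \<subseteq> V" and Y: "smooth_vf (atlas M) V' Y" for V' Y
  proof -
    interpret S: framed_foliation M V' D m Xf Zf by (rule restrict[OF V'(1,3)])
    show ?thesis by (rule S.ric_bott_tensor[OF V'(2) smooth_vf_subset[OF X V'(3)] Y])
  qed
  show "Ric_op M bc Xf X p \<in> T p"
    "smooth_vf_near (atlas M) p Y \<Longrightarrow> g p (Ric_op M bc Xf X p) (Y p) = ric_hor M bc Xf X Y p"
    unfolding Ric_op_def
    using op_of_form[where B="ric_hor M bc Xf" and X=X, OF p *] by auto
qed

lemma delta_adjoint:
  assumes p: "p \<in> V" and X: "vf X"
  defines "d \<equiv> metric_adjoint M (delta_torsion M D Xf) X p"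
  shows "d \<in> T p"
    and "smooth_vf_near (atlas M) p Y \<Longrightarrow> g p d (Y p) = g p (X p) (delta_torsion M D Xf Y p)"
proof -
  let ?B = "\<lambda>X Y p. g p (X p) (delta_torsion M D Xf Y p)"
  have *: "?B X Y p = (\<Sum>i<DIM('b). g p (Y p) (Xf i p) * ?B X (Xf i) p)
    + (\<Sum>l<m. g p (Y p) (Zf l p) * ?B X (Zf l) p)"
    if V': "open V'" "p \<in> V'" "V' \<subseteq> V" and Y: "smooth_vf (atlas M) V' Y" for V' Y
  proof -
    interpret S: framed_foliation M V' D m Xf Zf by (rule restrict[OF V'(1,3)])
    show ?thesis by (rule S.delta_torsion_tensor[OF V'(2) vf_tangent[OF X p] Y])
  qed
  show "d \<in> T p"
    "smooth_vf_near (atlas M) p Y \<Longrightarrow> g p d (Y p) = g p (X p) (delta_torsion M D Xf Y p)"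
    unfolding d_def metric_adjoint_def
    using op_of_form[where B="?B" and X=X, OF p *] by auto
qed

lemma Ric_adjoint:
  assumes p: "p \<in> V" and X: "vf X"
  shows "Ric_op M (adjoint_conn M D \<epsilon>) Xf X p = Ric_op M bc Xf X p
    - (1 / \<epsilon>) \<cdot>\<^sub>t metric_adjoint M (delta_torsion M D Xf) X p
    + (1 / \<epsilon>) \<cdot>\<^sub>t J_squared M D m Zf X p"
    (is "_ = ?r - _ \<cdot>\<^sub>t ?d + _ \<cdot>\<^sub>t ?j")
proof -
  have t: "?r \<in> T p" "?d \<in> T p" "?j \<in> T p"
    by (rule Ric_bott(1)[OF p X], rule delta_adjoint(1)[OF p X], rule J_squared_metric(1)[OF p X X])
  show ?thesis
    unfolding Ric_op_def[of M "adjoint_conn M D \<epsilon>"]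
  proof (rule op_of_formI[OF p])
    show "?r - (1 / \<epsilon>) \<cdot>\<^sub>t ?d + (1 / \<epsilon>) \<cdot>\<^sub>t ?j \<in> T p"
      by (rule tangent_add[OF tangent_minus[OF t(1) tangent_scale[OF t(2)]] tangent_scale[OF t(3)]])
    fix Y assume Y: "smooth_vf_near (atlas M) p Y"
    then obtain W where W: "open W" "p \<in> W" "smooth_vf (atlas M) W Y"
      unfolding smooth_vf_near_def by blast
    interpret S: framed_foliation M "V \<inter> W" D m Xf Zf
      by (rule restrict) (use W openV in auto)
    have v: "S.vf X" "S.vf Y" "p \<in> V \<inter> W" 
      using smooth_vf_subset[OF X, of "V \<inter> W"] smooth_vf_subset[OF W(3), of "V \<inter> W"] W p by simp_all
    have "g p (?r - (1 / \<epsilon>) \<cdot>\<^sub>t ?d + (1 / \<epsilon>) \<cdot>\<^sub>t ?j) (Y p)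
        = g p ?r (Y p) - (1 / \<epsilon>) * g p ?d (Y p) + (1 / \<epsilon>) * g p ?j (Y p)"
      using S.vf_tangent[OF v(2,3)] t
      by (simp add: g_add_left g_minus_left g_scale_left tangent_minus tangent_scale)
    also have "\<dots> = ric_hor M (adjoint_conn M D \<epsilon>) Xf X Y p"
      using S.ric_adjoint[OF v(3,1,2)] Ric_bott(2)[OF p X Y] delta_adjoint(2)[OF p X Y] by simp
    finally show "g p (?r - (1 / \<epsilon>) \<cdot>\<^sub>t ?d + (1 / \<epsilon>) \<cdot>\<^sub>t ?j) (Y p)
        = ric_hor M (adjoint_conn M D \<epsilon>) Xf X Y p" .
  qed
qed

end


theorem lemma5p6:
  fixes M :: "('a::{t2_space,second_countable_topology}, 'e::euclidean_space, 'i,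
                'b::euclidean_space) foliated"
    and nablaR :: "'a vfield \<Rightarrow> 'a vfield \<Rightarrow> 'a vfield"
    and m :: nat
    and \<epsilon> :: real
    and U :: "'a set"
    and Xf Zf :: "nat \<Rightarrow> 'a vfield"
    and X :: "'a vfield"
  assumes "totally_geodesic_riemannian_foliation M nablaR m"
    and "\<epsilon> > 0"
    and "open U"
    and "orthonormal_frame M (hor M) DIM('b) U Xf"
    and "orthonormal_frame M (vert M) m U Zf"
    and "smooth_vf (atlas M) U X"
  shows "\<forall>p\<in>U. Ric_op M (adjoint_conn M nablaR \<epsilon>) Xf X p =
           Ric_op M (bott M nablaR) Xf X p
           - (1 / \<epsilon>) \<cdot>\<^sub>t metric_adjoint M (delta_torsion M nablaR Xf) X p
           + (1 / \<epsilon>) \<cdot>\<^sub>t J_squared M nablaR m Zf X p"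
proof -
  have m: "framed_foliation M U nablaR m Xf Zf"
    using assms unfolding totally_geodesic_riemannian_foliation_def
    by unfold_locales auto
  show ?thesis
    by (intro ballI framed_foliation.Ric_adjoint[OF m]) (use assms in auto)
qed

end
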